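(* Let $d\ge2$. Suppose that $X_1,\ldots,X_d$ are identically distributed (not necessarily independent), that $X=(X_1,\ldots,X_d)$ has copula density $c$, and that the common marginal law has continuous, strictly increasing distribution function $\Phi$ and density $\phi$, so that $X$ has density $$f(x)=c\big(\Phi(x_1),\ldots,\Phi(x_d)\big)\prod_{k=1}^d\phi(x_k).$$ Let $\gamma$ be an integrable non-negative function on $\Delta(0,\mathrm{id})$ and $\varepsilon:\{0,1\}^d\times S_d\to[-1,1]$ with $$\gamma(u)\le\min_{(\alpha,\beta):\,\varepsilon(\alpha,\beta)>0}\frac{c(\tau_\alpha(\sigma_{\beta^{-1}}(u)))}{\varepsilon(\alpha,\beta)}\quad\text{for all }u\in\Delta(0,\mathrm{id}),$$ and suppose that $$\forall\alpha\in\{0,1\}^d,\quad\sum_{\beta\in S_d}\varepsilon(\sigma_{\beta^{-1}}(\alpha),\beta)=0$$ and $$\forall j,k\in[d],\quad\sum_{a\in\{0,1\}^{d-1},\,b\in S_{d-1}}\varepsilon(\omega_k(a,0),\chi_j(b,k))=\sum_{a\in\{0,1\}^{d-1},\,b\in S_{d-1}}\varepsilon(\omega_k(a,1),\chi_j(b,k))=0.$$ Define $$\theta_{\varepsilon,\gamma}(u)=c(u)-\sum_{\alpha,\beta}\varepsilon(\alpha,\beta)\,\gamma(\sigma_\beta(\tau_\alpha(u)))\,1_{\Delta(\alpha,\beta)}(u),\qquad u\in[0,1]^d.$$ Then $$\varphi(x)=\theta_{\varepsilon,\gamma}\big(\Phi(x_1),\ldots,\Phi(x_d)\big)\prod_{k=1}^d\phi(x_k)$$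 is the density of a random vector $Y=(Y_1,\ldots,Y_d)$ such that $Y_k$ has the same law as $X_k$ for every $k\in[d]$, and $g(Y)$ has the same law as $g(X)$ for every measurable symmetric function $g$ on $\mathbb R^d$.
   Context: $[d]=\{1,\ldots,d\}$ and $S_d$ is the set of permutations of $[d]$. For $\beta\in S_d$ and a $d$-tuple $u$, $\sigma_\beta(u)=(u_{\beta(1)},\ldots,u_{\beta(d)})$. A function $g$ is symmetric if $g\circ\sigma_\beta=g$ for all $\beta\in S_d$. For $\alpha\in\{0,1\}^d$, $\tau_\alpha(u)=\big(\alpha_i(1-u_i)+(1-\alpha_i)u_i\big)_{i=1}^d$. $\Delta(0,\mathrm{id})=\{u\in[0,1]^d: u_1<u_2<\cdots<u_d<1/2\}$ and for $(\alpha,\beta)\in\{0,1\}^d\times S_d$, $\Delta(\alpha,\beta)=\{u\in[0,1]^d:\sigma_\beta(\tau_\alpha(u))\in\Delta(0,\mathrm{id})\}$; the term $\gamma(\sigma_\beta(\tau_\alpha(u)))1_{\Delta(\alpha,\beta)}(u)$ is $0$ when $u\notin\Delta(\alpha,\beta)$. For a $(d-1)$-tuple $v$, a scalar $r$ and $k\in[d]$, $\omega_k(v,r)=(v_1,\ldots,v_{k-1},r,v_k,\ldots,v_{d-1})$ ($r$ inserted in position $k$). For $b\in S_{d-1}$ and $j,k\in[d]$, $\beta=\chi_j(b,k)\in S_d$ is given by: $\beta(j)=k$; for $i\le j-1$, $\beta(i)=b(i)$ if $b(i)\le k-1$ and $\beta(i)=b(i)+1$ if $b(i)\ge k$; for $i\ge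 j+1$, $\beta(i)=b(i-1)$ if $b(i-1)\le k-1$ and $\beta(i)=b(i-1)+1$ if $b(i-1)\ge k$. A copula density is a probability density on $[0,1]^d$ all of whose one-dimensional marginals are uniform on $[0,1]$. A minimum over the empty set is $+\infty$. Densities are with respect to Lebesgue measure. *)

theory Defs
  imports "HOL-Probability.Probability"
begin

text \<open>
  A \<open>d\<close>-tuple is a function on \<open>{1..d}\<close> that is \<open>undefined\<close> elsewhere, as in the space of
  \<open>Pi\<^sub>M {1..d}\<close>, so that equal tuples are equal functions.
\<close>

abbreviation lebesgue_tuples :: "nat \<Rightarrow> (nat \<Rightarrow> real) measure" where
  "lebesgue_tuples d \<equiv> Pi\<^sub>M {1..d} (\<lambda>_. lborel)"

definition unit_cube :: "nat \<Rightarrow> (nat \<Rightarrow> real) set" where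
  "unit_cube d = {1..d} \<rightarrow>\<^sub>E {0..1}"

definition bits :: "nat \<Rightarrow> (nat \<Rightarrow> real) set" where
  "bits d = {1..d} \<rightarrow>\<^sub>E {0, 1}"

definition perms :: "nat \<Rightarrow> (nat \<Rightarrow> nat) set" where
  "perms d = {\<beta>. \<beta> permutes {1..d}}"

definition sigma_perm :: "nat \<Rightarrow> (nat \<Rightarrow> nat) \<Rightarrow> (nat \<Rightarrow> 'a) \<Rightarrow> nat \<Rightarrow> 'a" where
  "sigma_perm d \<beta> u = (\<lambda>i\<in>{1..d}. u (\<beta> i))"

definition tau_flip :: "nat \<Rightarrow> (nat \<Rightarrow> real) \<Rightarrow> (nat \<Rightarrow> real) \<Rightarrow> nat \<Rightarrow> real" where
  "tau_flip d \<alpha> u = (\<lambda>i\<in>{1..d}. \<alpha> i * (1 - u i) + (1 - \<alpha> i) * u i)"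

definition symmetric_on_tuples :: "nat \<Rightarrow> ((nat \<Rightarrow> real) \<Rightarrow> 'b) \<Rightarrow> bool" where
  "symmetric_on_tuples d g \<longleftrightarrow>
     (\<forall>\<beta>\<in>perms d. \<forall>x\<in>{1..d} \<rightarrow>\<^sub>E UNIV. g (sigma_perm d \<beta> x) = g x)"

definition Delta0 :: "nat \<Rightarrow> (nat \<Rightarrow> real) set" where
  "Delta0 d = {u \<in> unit_cube d. (\<forall>i\<in>{1..<d}. u i < u (i + 1)) \<and> u d < 1 / 2}"

definition Delta :: "nat \<Rightarrow> (nat \<Rightarrow> real) \<Rightarrow> (nat \<Rightarrow> nat) \<Rightarrow> (nat \<Rightarrow> real) set" where
  "Delta d \<alpha> \<beta> = {u \<in> unit_cube d. sigma_perm d \<beta> (tau_flip d \<alpha> u) \<in> Delta0 d}"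

definition omega_insert :: "nat \<Rightarrow> nat \<Rightarrow> (nat \<Rightarrow> 'a) \<Rightarrow> 'a \<Rightarrow> nat \<Rightarrow> 'a" where
  "omega_insert d k v r = (\<lambda>i\<in>{1..d}. if i < k then v i else if i = k then r else v (i - 1))"

text \<open>
  No bound \<open>d\<close> is needed here: if \<open>b\<close> fixes everything outside \<open>{1..d - 1}\<close> and
  \<open>j, k \<in> {1..d}\<close>, the formula yields the identity outside \<open>{1..d}\<close>.
\<close>

definition chi_insert :: "nat \<Rightarrow> (nat \<Rightarrow> nat) \<Rightarrow> nat \<Rightarrow> nat \<Rightarrow> nat" where
  "chi_insert j b k i =
     (if i = j then k
      else if i < j then (if b i < k then b i else b i + 1)
      else (if b (i - 1) < k then b (i - 1) else b (i - 1) + 1))"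

lemma chi_insert_in_perms:
  assumes b: "b \<in> perms (d - 1)" and j: "j \<in> {1..d}" and k: "k \<in> {1..d}"
  shows "chi_insert j b k \<in> perms d"
proof -
  have bp: "b permutes {1..d - 1}" using b by (simp add: perms_def)
  have inj: "b x = b y \<longleftrightarrow> x = y" for x y
    using permutes_inj[OF bp] by (auto dest: injD)
  have out: "b i = i" if "i \<notin> {1..d - 1}" for i
    using bp that by (rule permutes_not_in)
  have fix_out: "chi_insert j b k i = i" if i: "i \<notin> {1..d}" for i
  proof (cases "i = 0")
    case True
    then show ?thesis using j k out[of 0] by (auto simp: chi_insert_def)
  next
    case False
    then have "i - 1 \<notin> {1..d - 1}" using i by auto
    then show ?thesis using False i j k out[of "i - 1"] by (auto simp: chi_insert_def)
  qed
  have shift: "(if p < k then p else p + 1) = (if q < k then q else q + 1) \<longleftrightarrow> p = q"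
    "(if p < k then p else p + 1) \<noteq> k" for p q :: nat
    by auto
  have inj': "inj (chi_insert j b k)"
  proof (rule injI)
    fix x y assume eq: "chi_insert j b k x = chi_insert j b k y"
    define s where "s i = (if i < j then i else i - 1)" for i :: nat
    have chi: "chi_insert j b k i =
        (if i = j then k else if b (s i) < k then b (s i) else b (s i) + 1)" for i
      by (simp add: chi_insert_def s_def)
    have s_inj: "x = y" if "s x = s y" "x \<noteq> j" "y \<noteq> j"
      using that by (auto simp: s_def split: if_splits)
    show "x = y"
    proof (cases "x = j \<or> y = j")
      case True
      then show ?thesis using eq shift(2) unfolding chi by metis
    next
      case False
      then have "b (s x) = b (s y)" using eq shift(1) unfolding chi by simp
      then show ?thesis using False s_inj inj by blast
    qed
  qed
  have "chi_insert j b k ` {1..d} \<subseteq> {1..d}"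
  proof (rule image_subsetI, rule ccontr)
    fix i assume i: "i \<in> {1..d}" and n: "chi_insert j b k i \<notin> {1..d}"
    then have "chi_insert j b k (chi_insert j b k i) = chi_insert j b k i" by (simp add: fix_out)
    then show False using injD[OF inj'] i n by metis
  qed
  moreover have on: "inj_on (chi_insert j b k) {1..d}"
    using inj' by (rule inj_on_subset) simp
  ultimately have "chi_insert j b k ` {1..d} = {1..d}"
    by (intro endo_inj_surj) simp_all
  with on have "bij_betw (chi_insert j b k) {1..d} {1..d}"
    by (simp add: bij_betw_def)
  then show ?thesis
    unfolding perms_def using bij_imp_permutes fix_out by blast
qed

definition cube_measure :: "nat \<Rightarrow> ((nat \<Rightarrow> real) \<Rightarrow> real) \<Rightarrow> (nat \<Rightarrow> real) measure" where
  "cube_measure d c =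
     density (restrict_space (lebesgue_tuples d) (unit_cube d)) (\<lambda>u. ennreal (c u))"

definition copula_density :: "nat \<Rightarrow> ((nat \<Rightarrow> real) \<Rightarrow> real) \<Rightarrow> bool" where
  "copula_density d c \<longleftrightarrow>
     c \<in> borel_measurable (restrict_space (lebesgue_tuples d) (unit_cube d)) \<and>
     (\<forall>u\<in>unit_cube d. 0 \<le> c u) \<and>
     prob_space (cube_measure d c) \<and>
     (\<forall>k\<in>{1..d}. distr (cube_measure d c) borel (\<lambda>u. u k) = uniform_measure lborel {0..1})"

text \<open>Sklar's relation \<open>F(x) = C(F\<^sub>1(x\<^sub>1), \<dots>, F\<^sub>d(x\<^sub>d))\<close>, \<open>C\<close> being the copula with density \<open>c\<close>.\<close>

definition has_copula_density ::
    "'a measure \<Rightarrow> nat \<Rightarrow> ('a \<Rightarrow> nat \<Rightarrow> real) \<Rightarrow> ((nat \<Rightarrow> real) \<Rightarrow> real) \<Rightarrow> bool" where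
  "has_copula_density M d X c \<longleftrightarrow>
     copula_density d c \<and>
     (\<forall>x. measure M {w \<in> space M. \<forall>k\<in>{1..d}. X w k \<le> x k} =
          measure (cube_measure d c)
            {u \<in> unit_cube d. \<forall>k\<in>{1..d}. u k \<le> cdf (distr M borel (\<lambda>w. X w k)) (x k)})"

text \<open>Nonnegativity is required separately because \<open>ennreal\<close> truncates negative values to \<open>0\<close>.\<close>

definition has_density ::
    "'a measure \<Rightarrow> nat \<Rightarrow> ('a \<Rightarrow> nat \<Rightarrow> real) \<Rightarrow> ((nat \<Rightarrow> real) \<Rightarrow> real) \<Rightarrow> bool" where
  "has_density M d X f \<longleftrightarrow>
     (\<forall>x\<in>space (lebesgue_tuples d). 0 \<le> f x) \<and>
     distributed M (lebesgue_tuples d) X (\<lambda>x. ennreal (f x))"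

definition joint_density ::
    "nat \<Rightarrow> ((nat \<Rightarrow> real) \<Rightarrow> real) \<Rightarrow> (real \<Rightarrow> real) \<Rightarrow> (real \<Rightarrow> real) \<Rightarrow> (nat \<Rightarrow> real) \<Rightarrow> real" where
  "joint_density d c \<Phi> \<phi> x = c (\<lambda>i\<in>{1..d}. \<Phi> (x i)) * (\<Prod>k\<in>{1..d}. \<phi> (x k))"

definition theta ::
    "nat \<Rightarrow> ((nat \<Rightarrow> real) \<Rightarrow> real) \<Rightarrow> ((nat \<Rightarrow> real) \<times> (nat \<Rightarrow> nat) \<Rightarrow> real) \<Rightarrow>
      ((nat \<Rightarrow> real) \<Rightarrow> real) \<Rightarrow> (nat \<Rightarrow> real) \<Rightarrow> real" where
  "theta d c \<epsilon> \<gamma> u =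
     c u - (\<Sum>(\<alpha>, \<beta>)\<in>bits d \<times> perms d.
       \<epsilon> (\<alpha>, \<beta>) * \<gamma> (sigma_perm d \<beta> (tau_flip d \<alpha> u)) * indicator (Delta d \<alpha> \<beta>) u)"

end

theory Submission
  imports Defs
begin

text \<open>
  Since \<open>\<Phi>\<close> is continuous and strictly increasing, \<open>x \<mapsto> (\<Phi>(x\<^sub>1), \<dots>, \<Phi>(x\<^sub>d))\<close> is injective and
  carries the density \<open>h(\<Phi>(x\<^sub>1), \<dots>, \<Phi>(x\<^sub>d)) \<Prod> \<phi>(x\<^sub>k)\<close> to the density \<open>h\<close> on the cube, so
  everything can be compared on the cube. The maps \<open>\<sigma>\<^sub>\<beta> \<circ> \<tau>\<^sub>\<alpha>\<close> preserve Lebesgue measure; the change of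
  variables \<open>u = \<tau>\<^sub>\<alpha>(\<sigma>\<^sub>\<beta>\<^sup>-\<^sup>1(v))\<close> therefore turns \<open>\<integral> F (c - \<theta>)\<close> into the integral over \<open>\<Delta>(0, id)\<close> of
  \<open>\<gamma>(v) \<Sum> \<epsilon>(\<alpha>, \<beta>) F(\<tau>\<^sub>\<alpha>(\<sigma>\<^sub>\<beta>\<^sup>-\<^sup>1(v)))\<close>. For symmetric \<open>F\<close> the inner sum, regrouped by
  \<open>\<sigma>\<^sub>\<beta>(\<alpha>)\<close>, vanishes by the first condition on \<open>\<epsilon>\<close>; for \<open>F\<close> depending on the coordinate \<open>u\<^sub>k\<close> only
  it vanishes by the second one, regrouped by \<open>(\<beta>\<^sup>-\<^sup>1(k), \<alpha>\<^sub>k)\<close>. As the simplices \<open>\<Delta>(\<alpha>, \<beta>)\<close> are disjoint,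
  at most one summand of \<open>\<theta>\<close> is nonzero at each point, which gives \<open>\<theta> \<ge> 0\<close>.
\<close>

section \<open>Flips and permutations of tuples\<close>

lemma finite_perms: "finite (perms d)"
  unfolding perms_def by (simp add: finite_permutations)

lemma card_perms: "card (perms d) = fact d"
  unfolding perms_def by (rule card_permutations) auto

lemma finite_bits: "finite (bits d)"
  unfolding bits_def by (intro finite_PiE) auto

lemma card_bits: "card (bits d) = 2 ^ d"
  unfolding bits_def by (simp add: card_PiE numeral_2_eq_2)

lemma bits_cases: "\<alpha> \<in> bits d \<Longrightarrow> i \<in> {1..d} \<Longrightarrow> \<alpha> i = 0 \<or> \<alpha> i = 1"
  unfolding bits_def by (auto simp: PiE_iff)

lemma perms_in: "\<beta> \<in> perms d \<Longrightarrow> \<beta> i \<in> {1..d} \<longleftrightarrow> i \<in> {1..d}"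
  unfolding perms_def using permutes_in_image[of \<beta> "{1..d}" i] by blast

lemma inv_perms: "\<beta> \<in> perms d \<Longrightarrow> inv \<beta> \<in> perms d"
  unfolding perms_def by (auto intro: permutes_inv)

lemma perms_inv_apply:
  assumes "\<beta> \<in> perms d" shows "\<beta> (inv \<beta> i) = i" "inv \<beta> (\<beta> i) = i"
  using assms permutes_inverses unfolding perms_def by fast+

lemma sigma_perm_extensional [simp]: "sigma_perm d \<beta> u \<in> extensional {1..d}"
  unfolding sigma_perm_def by simp

lemma tau_flip_extensional [simp]: "tau_flip d \<alpha> u \<in> extensional {1..d}"
  unfolding tau_flip_def by simp

lemma bits_extensional: "\<alpha> \<in> bits d \<Longrightarrow> \<alpha> \<in> extensional {1..d}"
  unfolding bits_def by (auto simp: PiE_iff)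

text \<open>\<open>sigma_perm\<close> turns every value outside the index range into
  \<open>undefined\<close>, so only extensional tuples can be recovered.\<close>

lemma sigma_perm_inverse:
  assumes "\<beta> \<in> perms d" "u \<in> extensional {1..d}"
  shows "sigma_perm d (inv \<beta>) (sigma_perm d \<beta> u) = u"
    and "sigma_perm d \<beta> (sigma_perm d (inv \<beta>) u) = u"
  using assms perms_in[OF inv_perms[OF assms(1)]] perms_in[OF assms(1)]
  by (intro extensionalityI[OF sigma_perm_extensional assms(2)],
      simp add: sigma_perm_def perms_inv_apply del: One_nat_def atLeastAtMost_iff)+

lemma tau_flip_involution:
  assumes "\<alpha> \<in> bits d" "u \<in> extensional {1..d}"
  shows "tau_flip d \<alpha> (tau_flip d \<alpha> u) = u"
  using bits_cases[OF assms(1)] assms(2)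
  by (intro extensionalityI[OF tau_flip_extensional]) (force simp: tau_flip_def)+

text \<open>A flip acts coordinate by coordinate, so a permutation applied afterwards moves the bits
  along with the tuple.\<close>

lemma sigma_tau:
  assumes "\<beta> \<in> perms d"
  shows "sigma_perm d \<beta> (tau_flip d \<alpha> u) = tau_flip d (sigma_perm d \<beta> \<alpha>) (sigma_perm d \<beta> u)"
  using perms_in[OF assms] unfolding sigma_perm_def tau_flip_def by (auto simp: fun_eq_iff)

lemma sigma_perm_bits:
  assumes "\<beta> \<in> perms d" "\<alpha> \<in> bits d" shows "sigma_perm d \<beta> \<alpha> \<in> bits d"
  using perms_in[OF assms(1)] assms(2) unfolding sigma_perm_def bits_def by (auto simp: PiE_iff)

lemma flip_perm_inverse:
  assumes "\<alpha> \<in> bits d" "\<beta> \<in> perms d" "u \<in> extensional {1..d}"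
  shows "tau_flip d \<alpha> (sigma_perm d (inv \<beta>) (sigma_perm d \<beta> (tau_flip d \<alpha> u))) = u"
  using assms
  by (simp_all add: tau_flip_involution sigma_perm_inverse del: One_nat_def)

lemma tau_flip_unit_cube:
  assumes "\<alpha> \<in> bits d" "u \<in> unit_cube d" shows "tau_flip d \<alpha> u \<in> unit_cube d"
  using assms(2) bits_cases[OF assms(1)] unfolding tau_flip_def unit_cube_def
  by (fastforce simp: PiE_iff)

lemma sigma_perm_unit_cube:
  assumes "\<beta> \<in> perms d" "u \<in> unit_cube d" shows "sigma_perm d \<beta> u \<in> unit_cube d"
  using assms(2) perms_in[OF assms(1)] unfolding sigma_perm_def unit_cube_def by (auto simp: PiE_iff)

text \<open>Disjointness of the simplices: being below 1/2 after the flip fixes every bit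
  \<open>\<alpha> i\<close>; then \<beta> must list the flipped coordinates in increasing order, and
  distinct coordinates have only one such listing.\<close>

lemma flip_perm_Delta0_unique:
  assumes a: "\<alpha> \<in> bits d" "\<alpha>' \<in> bits d" and b: "\<beta> \<in> perms d" "\<beta>' \<in> perms d"
    and D: "sigma_perm d \<beta> (tau_flip d \<alpha> u) \<in> Delta0 d"
           "sigma_perm d \<beta>' (tau_flip d \<alpha>' u) \<in> Delta0 d"
  shows "\<alpha> = \<alpha>' \<and> \<beta> = \<beta>'"
proof -
  \<comment> \<open>\<open>Delta0\<close> orders consecutive coordinates only; induction along the
    chain orders all pairs.\<close>
  have mono: "v i < v j" if "v \<in> Delta0 d" "i < j" "i \<in> {1..d}" "j \<in> {1..d}" for v i j
    using \<open>i < j\<close> that(3,4)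
  proof (induction rule: less_Suc_induct)
    case (1 i)
    then show ?case using that(1) by (auto simp: Delta0_def)
  next
    case (2 x y z)
    then have "y \<in> {1..d}" by auto
    with 2 show ?case by force
  qed
  \<comment> \<open>Coordinate \<open>i\<close> of the flipped tuple sits at position
    \<open>inv \<beta> i\<close> of the sorted one, whose last entry is its largest.\<close>
  have half: "tau_flip d \<alpha> u i < 1/2"
    if "\<beta> \<in> perms d" "sigma_perm d \<beta> (tau_flip d \<alpha> u) \<in> Delta0 d" "i \<in> {1..d}" for \<alpha> \<beta> i
  proof -
    let ?v = "sigma_perm d \<beta> (tau_flip d \<alpha> u)"
    have j: "inv \<beta> i \<in> {1..d}" using perms_in[OF inv_perms[OF that(1)]] that(3) by simp
    have "?v (inv \<beta> i) \<le> ?v d"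
      using mono[OF that(2), of "inv \<beta> i" d] j by (cases "inv \<beta> i = d") auto
    also have "\<dots> < 1/2" using that(2) by (auto simp: Delta0_def)
    finally show ?thesis using j perms_inv_apply(1)[OF that(1)] by (simp add: sigma_perm_def)
  qed
  \<comment> \<open>Different bits would make both \<open>u i\<close> and \<open>1 - u i\<close>
    less than 1/2.\<close>
  have "\<alpha> i = \<alpha>' i" if i: "i \<in> {1..d}" for i
    using half[OF b(1) D(1) i] half[OF b(2) D(2) i] bits_cases[OF a(1) i] bits_cases[OF a(2) i] i
    by (auto simp: tau_flip_def)
  then have aa: "\<alpha> = \<alpha>'" using bits_extensional[OF a(1)] bits_extensional[OF a(2)]
    by (intro extensionalityI) auto
  define v where "v = tau_flip d \<alpha> u"
  have D': "sigma_perm d \<beta> v \<in> Delta0 d" "sigma_perm d \<beta>' v \<in> Delta0 d"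
    using D aa by (simp_all add: v_def)
  \<comment> \<open>Both sorted lists enumerate the same value set of \<open>v\<close> in strictly
    increasing order, so they are one list.\<close>
  have sm: "sorted_wrt (<) (map (sigma_perm d \<beta> v) [1..<d+1])"
    "set (map (sigma_perm d \<beta> v) [1..<d+1]) = v ` {1..d}"
    if "\<beta> \<in> perms d" "sigma_perm d \<beta> v \<in> Delta0 d" for \<beta>
  proof -
    show "sorted_wrt (<) (map (sigma_perm d \<beta> v) [1..<d+1])"
      unfolding sorted_wrt_map
      by (rule sorted_wrt_mono_rel[OF _ sorted_wrt_upt]) (use mono[OF that(2)] in auto)
    have "set (map (sigma_perm d \<beta> v) [1..<d+1]) = sigma_perm d \<beta> v ` {1..d}"
      by (simp add: atLeastLessThanSuc_atLeastAtMost del: upt_Suc)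
    also have "\<dots> = (\<lambda>i. v (\<beta> i)) ` {1..d}"
      by (rule image_cong) (simp_all add: sigma_perm_def)
    also have "\<dots> = v ` (\<beta> ` {1..d})" by (simp only: image_image)
    also have "\<beta> ` {1..d} = {1..d}" using that(1) unfolding perms_def by (simp only: mem_Collect_eq permutes_image)
    finally show "set (map (sigma_perm d \<beta> v) [1..<d+1]) = v ` {1..d}" .
  qed
  have "map (sigma_perm d \<beta> v) [1..<d+1] = map (sigma_perm d \<beta>' v) [1..<d+1]"
    using sm[OF b(1) D'(1)] sm[OF b(2) D'(2)] by (intro strict_sorted_equal) auto
  then have eq: "v (\<beta> i) = v (\<beta>' i)" if "i \<in> {1..d}" for i
    using that by (auto simp: sigma_perm_def simp del: upt_Suc)
  \<comment> \<open>Sorting the values of \<open>v\<close> gives a strict chain, so equal values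
    come from equal indices.\<close>
  have inj: "x = y" if "v x = v y" "x \<in> {1..d}" "y \<in> {1..d}" for x y
  proof -
    have i: "inv \<beta> x \<in> {1..d}" "inv \<beta> y \<in> {1..d}"
      using perms_in[OF inv_perms[OF b(1)]] that by auto
    have "sigma_perm d \<beta> v (inv \<beta> x) = sigma_perm d \<beta> v (inv \<beta> y)"
      using i that by (simp add: sigma_perm_def perms_inv_apply[OF b(1)])
    then have "inv \<beta> x = inv \<beta> y"
      using mono[OF D'(1)] i by (metis less_irrefl linorder_neqE_nat)
    then show ?thesis using perms_inv_apply[OF b(1)] by metis
  qed
  have "\<beta> i = \<beta>' i" for i
  proof (cases "i \<in> {1..d}")
    case True then show ?thesis using eq inj perms_in b by blast
  next
    case False then show ?thesis using b permutes_not_in[OF _ False] unfolding perms_def by (metis mem_Collect_eq)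
  qed
  then show ?thesis using aa by auto
qed

text \<open>Injectivity and the count 2 * 2^(d-1) = 2^d give surjectivity without an explicit
  inverse.\<close>

lemma bij_betw_omega_insert:
  assumes k: "k \<in> {1..d}"
  shows "bij_betw (\<lambda>(r, a). omega_insert d k a r) ({0, 1} \<times> bits (d - 1)) (bits d)"
proof -
  have inj: "inj_on (\<lambda>(r, a). omega_insert d k a r) ({0, 1} \<times> bits (d - 1))"
  proof (rule inj_onI, clarify)
    fix r a r' a' assume a: "a \<in> bits (d - 1)" "a' \<in> bits (d - 1)"
      and eq: "omega_insert d k a r = omega_insert d k a' r'"
    have r: "r = r'" using fun_cong[OF eq, of k] k by (simp add: omega_insert_def)
    have "a i = a' i" if "i \<in> {1..d - 1}" for i
    proof (cases "i < k")
      case True then show ?thesis using fun_cong[OF eq, of i] that by (simp add: omega_insert_def split: if_splits)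
    next
      \<comment> \<open>Entries from position \<open>k\<close> on are shifted by one, so entry
        \<open>i\<close> is read off at \<open>i + 1\<close>.\<close>
      case False then show ?thesis using fun_cong[OF eq, of "i + 1"] that
        by (auto simp: omega_insert_def split: if_splits)
    qed
    then have "a = a'" using a by (intro extensionalityI[OF bits_extensional bits_extensional]) auto
    with r show "r = r' \<and> a = a'" by simp
  qed
  have sub: "(\<lambda>(r, a). omega_insert d k a r) ` ({0, 1} \<times> bits (d - 1)) \<subseteq> bits d"
  proof (clarify)
    fix r :: real and a assume r: "r \<in> {0, 1}" and a: "a \<in> bits (d - 1)"
    have ai: "a i \<in> {0, 1}" if "1 \<le> i" "i \<le> d - 1" for i using bits_cases[OF a, of i] that by auto
    have "(if i < k then a i else if i = k then r else a (i - 1)) \<in> {0, 1}"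
      if "i \<in> {1..d}" for i
      using that r k ai[of i] ai[of "i - 1"] by (cases i k rule: linorder_cases) auto
    then show "omega_insert d k a r \<in> bits d"
      unfolding omega_insert_def bits_def restrict_PiE_iff by blast
  qed
  have "card ({0, 1 :: real} \<times> bits (d - 1)) = card (bits d)"
    using k by (cases d) (auto simp: card_cartesian_product card_bits)
  then have "(\<lambda>(r, a). omega_insert d k a r) ` ({0, 1} \<times> bits (d - 1)) = bits d"
    using sub by (intro card_subset_eq[OF finite_bits]) (simp_all only: card_image[OF inj])
  with inj show ?thesis by (simp add: bij_betw_def)
qed

text \<open>A permutation of the longer range loses the preimage \<open>j\<close> of
  \<open>k\<close> from its domain and \<open>k\<close> from its range; closing both gaps leaves
  \<open>b\<close>. The count d * (d-1)! = d! replaces an explicit inverse.\<close>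

lemma bij_betw_chi_insert:
  assumes k: "k \<in> {1..d}"
  shows "bij_betw (\<lambda>(j, b). chi_insert j b k) ({1..d} \<times> perms (d - 1)) (perms d)"
proof -
  have at_j: "chi_insert j b k j = k" for j b by (simp add: chi_insert_def)
  have inj: "inj_on (\<lambda>(j, b). chi_insert j b k) ({1..d} \<times> perms (d - 1))"
  proof (rule inj_onI, clarify)
    fix j b j' b' assume j: "j \<in> {1..d}" "j' \<in> {1..d}" and b: "b \<in> perms (d - 1)" "b' \<in> perms (d - 1)"
      and eq: "chi_insert j b k = chi_insert j' b' k"
    have "inj (chi_insert j b k)"
      using chi_insert_in_perms[OF b(1) j(1) k] permutes_inj unfolding perms_def by fast
    \<comment> \<open>Only the inserted index is sent to \<open>k\<close>, so \<open>j\<close> is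
      determined.\<close>
    then have jj: "j = j'" using at_j[of j b] at_j[of j' b'] eq by (metis injD)
    have "b i = b' i" for i
    proof (cases "i < j")
      case True then show ?thesis using fun_cong[OF eq, of i] jj
        by (auto simp: chi_insert_def split: if_splits)
    next
      case False then show ?thesis using fun_cong[OF eq, of "i + 1"] jj
        by (auto simp: chi_insert_def split: if_splits)
    qed
    with jj show "j = j' \<and> b = b'" by auto
  qed
  have sub: "(\<lambda>(j, b). chi_insert j b k) ` ({1..d} \<times> perms (d - 1)) \<subseteq> perms d"
    using chi_insert_in_perms k by auto
  have "card ({1..d} \<times> perms (d - 1)) = card (perms d)"
    using k by (cases d) (auto simp: card_cartesian_product card_perms)
  then have "(\<lambda>(j, b). chi_insert j b k) ` ({1..d} \<times> perms (d - 1)) = perms d"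
    using sub by (intro card_subset_eq[OF finite_perms]) (simp_all only: card_image[OF inj])
  with inj show ?thesis by (simp add: bij_betw_def)
qed

text \<open>Permuting the argument by \<beta> leaves \<open>F\<close> unchanged, cancels the inner
  inverse permutation and replaces \<alpha> by \<open>sigma_perm d \<beta> \<alpha>\<close>. Summing
  over that bit tuple instead of \<alpha> frees the value of \<open>F\<close> from \<beta>, and the
  coefficient sum over \<beta> factors out.\<close>

lemma sum_symmetric_cancel:
  fixes F :: "(nat \<Rightarrow> real) \<Rightarrow> real"
  assumes \<epsilon>: "\<forall>\<alpha>\<in>bits d. (\<Sum>\<beta>\<in>perms d. \<epsilon> (sigma_perm d (inv \<beta>) \<alpha>, \<beta>)) = 0"
    and F: "symmetric_on_tuples d F" and v: "v \<in> extensional {1..d}"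
  shows "(\<Sum>(\<alpha>, \<beta>)\<in>bits d \<times> perms d. \<epsilon> (\<alpha>, \<beta>) * F (tau_flip d \<alpha> (sigma_perm d (inv \<beta>) v))) = 0"
proof -
  have Fs: "F (tau_flip d \<alpha> (sigma_perm d (inv \<beta>) v)) = F (tau_flip d (sigma_perm d \<beta> \<alpha>) v)"
    if "\<beta> \<in> perms d" for \<alpha> \<beta>
  proof -
    have "F (tau_flip d \<alpha> (sigma_perm d (inv \<beta>) v)) =
        F (sigma_perm d \<beta> (tau_flip d \<alpha> (sigma_perm d (inv \<beta>) v)))"
      using F that unfolding symmetric_on_tuples_def by (simp add: PiE_iff del: One_nat_def)
    then show ?thesis using that v by (simp add: sigma_tau sigma_perm_inverse)
  qed
  have "(\<Sum>(\<alpha>, \<beta>)\<in>bits d \<times> perms d. \<epsilon> (\<alpha>, \<beta>) * F (tau_flip d \<alpha> (sigma_perm d (inv \<beta>) v))) =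
      (\<Sum>\<beta>\<in>perms d. \<Sum>\<alpha>\<in>bits d. \<epsilon> (\<alpha>, \<beta>) * F (tau_flip d (sigma_perm d \<beta> \<alpha>) v))"
    by (subst sum.swap) (auto simp: sum.cartesian_product Fs intro!: sum.cong)
  also have "\<dots> = (\<Sum>\<beta>\<in>perms d. \<Sum>\<alpha>\<in>bits d. \<epsilon> (sigma_perm d (inv \<beta>) \<alpha>, \<beta>) * F (tau_flip d \<alpha> v))"
  proof (rule sum.cong[OF refl])
    fix \<beta> assume b: "\<beta> \<in> perms d"
    show "(\<Sum>\<alpha>\<in>bits d. \<epsilon> (\<alpha>, \<beta>) * F (tau_flip d (sigma_perm d \<beta> \<alpha>) v)) =
        (\<Sum>\<alpha>\<in>bits d. \<epsilon> (sigma_perm d (inv \<beta>) \<alpha>, \<beta>) * F (tau_flip d \<alpha> v))"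
      using b
      by (intro sum.reindex_bij_witness[where i = "sigma_perm d (inv \<beta>)" and j = "sigma_perm d \<beta>"])
        (auto simp: sigma_perm_bits inv_perms sigma_perm_inverse bits_extensional
            simp del: One_nat_def)
  qed
  also have "\<dots> = (\<Sum>\<alpha>\<in>bits d. (\<Sum>\<beta>\<in>perms d. \<epsilon> (sigma_perm d (inv \<beta>) \<alpha>, \<beta>)) * F (tau_flip d \<alpha> v))"
    by (subst sum.swap) (simp add: sum_distrib_right)
  also have "\<dots> = 0" using \<epsilon> by simp
  finally show ?thesis .
qed

text \<open>The \<open>k\<close>-th coordinate is \<open>v j\<close> or \<open>1 - v j\<close> with
  \<open>j = inv \<beta> k\<close>, the choice being made by the bit \<open>\<alpha> k\<close>. So
  the sum splits by the pair of that bit and \<open>j\<close>; the two insertion bijections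
  parametrise each class, on which the coefficients sum to zero.\<close>

lemma sum_coordinate_cancel:
  fixes f :: "real \<Rightarrow> real"
  assumes k: "k \<in> {1..d}"
    and \<epsilon>: "\<And>j r. j \<in> {1..d} \<Longrightarrow> r \<in> {0, 1} \<Longrightarrow>
      (\<Sum>(a, b)\<in>bits (d - 1) \<times> perms (d - 1). \<epsilon> (omega_insert d k a r, chi_insert j b k)) = 0"
  shows "(\<Sum>(\<alpha>, \<beta>)\<in>bits d \<times> perms d. \<epsilon> (\<alpha>, \<beta>) * f (tau_flip d \<alpha> (sigma_perm d (inv \<beta>) v) k)) = 0"
proof -
  let ?g = "\<lambda>r j. f (r * (1 - v j) + (1 - r) * v j)"
  let ?E = "\<lambda>r a j b. \<epsilon> (omega_insert d k a r, chi_insert j b k)"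
  \<comment> \<open>\<open>chi_insert j b k\<close> maps \<open>j\<close> to \<open>k\<close>, so
    the summation index \<open>j\<close> is the position where \<open>v\<close> is read.\<close>
  have inv_chi: "inv (chi_insert j b k) k = j" if "j \<in> {1..d}" "b \<in> perms (d - 1)" for j b
    using perms_inv_apply(2)[OF chi_insert_in_perms[OF that(2,1) k], of j]
    by (simp add: chi_insert_def)
  have "(\<Sum>(\<alpha>, \<beta>)\<in>bits d \<times> perms d. \<epsilon> (\<alpha>, \<beta>) * f (tau_flip d \<alpha> (sigma_perm d (inv \<beta>) v) k)) =
    (\<Sum>\<alpha>\<in>bits d. \<Sum>\<beta>\<in>perms d. \<epsilon> (\<alpha>, \<beta>) * ?g (\<alpha> k) (inv \<beta> k))"
    using k by (simp add: sum.cartesian_product tau_flip_def sigma_perm_def)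
  also have "\<dots> = (\<Sum>(r, a)\<in>{0, 1} \<times> bits (d - 1). \<Sum>(j, b)\<in>{1..d} \<times> perms (d - 1). ?E r a j b * ?g r j)"
    by (simp only: sum.reindex_bij_betw[OF bij_betw_omega_insert[OF k], symmetric]
          sum.reindex_bij_betw[OF bij_betw_chi_insert[OF k], symmetric])
      (use k in \<open>auto simp: inv_chi omega_insert_def intro!: sum.cong\<close>)
  also have "\<dots> = (\<Sum>r\<in>{0, 1}. \<Sum>a\<in>bits (d - 1). \<Sum>j\<in>{1..d}. \<Sum>b\<in>perms (d - 1). ?E r a j b * ?g r j)"
    by (simp only: sum.cartesian_product[symmetric])
  also have "\<dots> = (\<Sum>r\<in>{0, 1}. \<Sum>j\<in>{1..d}. \<Sum>a\<in>bits (d - 1). \<Sum>b\<in>perms (d - 1). ?E r a j b * ?g r j)"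
    by (intro sum.cong refl sum.swap)
  also have "\<dots> = (\<Sum>r\<in>{0, 1}. \<Sum>j\<in>{1..d}. (\<Sum>(a, b)\<in>bits (d - 1) \<times> perms (d - 1). ?E r a j b) * ?g r j)"
    by (simp only: sum.cartesian_product[symmetric] sum_distrib_right)
  also have "\<dots> = 0" by (intro sum.neutral ballI) (simp only: \<epsilon> mult_zero_left sum.neutral_const)
  finally show ?thesis .
qed

section \<open>Measures on tuples\<close>

declare One_nat_def [simp del]

text \<open>Boxes determine a sigma-finite product measure, and over a box the integral of a product
  of one-variable functions factorises.\<close>

lemma density_PiM:
  fixes f :: "'i \<Rightarrow> 'a \<Rightarrow> ennreal"
  assumes I: "finite I" and M: "\<And>i. sigma_finite_measure (M i)"
    and N: "\<And>i. sigma_finite_measure (density (M i) (f i))"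
    and f[measurable]: "\<And>i. f i \<in> borel_measurable (M i)"
  shows "density (Pi\<^sub>M I M) (\<lambda>x. \<Prod>i\<in>I. f i (x i)) = Pi\<^sub>M I (\<lambda>i. density (M i) (f i))"
proof -
  interpret M: product_sigma_finite M by (rule product_sigma_finite.intro) (rule M)
  interpret N: product_sigma_finite "\<lambda>i. density (M i) (f i)" by (rule product_sigma_finite.intro) (rule N)
  show ?thesis
  proof (rule N.PiM_eqI[OF I])
    show "sets (density (Pi\<^sub>M I M) (\<lambda>x. \<Prod>i\<in>I. f i (x i))) = sets (Pi\<^sub>M I (\<lambda>i. density (M i) (f i)))"
      by (simp cong: sets_PiM_cong)
  next
    fix A assume A: "\<And>i. i \<in> I \<Longrightarrow> A i \<in> sets (density (M i) (f i))"
    then have A'[measurable]: "i \<in> I \<Longrightarrow> A i \<in> sets (M i)" for i by simp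
    have "emeasure (density (Pi\<^sub>M I M) (\<lambda>x. \<Prod>i\<in>I. f i (x i))) (Pi\<^sub>E I A) =
        (\<integral>\<^sup>+x. (\<Prod>i\<in>I. f i (x i)) * indicator (Pi\<^sub>E I A) x \<partial>Pi\<^sub>M I M)"
      using I by (intro emeasure_density) (auto intro!: sets_PiM_I_finite A')
    also have "\<dots> = (\<integral>\<^sup>+x. (\<Prod>i\<in>I. f i (x i) * indicator (A i) (x i)) \<partial>Pi\<^sub>M I M)"
    \<comment> \<open>Points of the product space are extensional, so lying in the box is a
      condition on each coordinate and the indicator is a product.\<close>
    proof (rule nn_integral_cong)
      fix x assume "x \<in> space (Pi\<^sub>M I M)"
      then have "x \<in> extensional I" by (auto simp: space_PiM PiE_iff)
      then have "indicator (Pi\<^sub>E I A) x = (\<Prod>i\<in>I. indicator (A i) (x i) :: ennreal)"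
        using I by (auto simp: indicator_def PiE_iff prod_zero_iff)
      then show "(\<Prod>i\<in>I. f i (x i)) * indicator (Pi\<^sub>E I A) x = (\<Prod>i\<in>I. f i (x i) * indicator (A i) (x i))"
        by (simp add: prod.distrib)
    qed
    also have "\<dots> = (\<Prod>i\<in>I. \<integral>\<^sup>+x. f i x * indicator (A i) x \<partial>M i)"
      using I by (intro M.product_nn_integral_prod) auto
    also have "\<dots> = (\<Prod>i\<in>I. emeasure (density (M i) (f i)) (A i))"
      by (intro prod.cong refl) (simp add: emeasure_density)
    finally show "emeasure (density (Pi\<^sub>M I M) (\<lambda>x. \<Prod>i\<in>I. f i (x i))) (Pi\<^sub>E I A) =
      (\<Prod>i\<in>I. emeasure (density (M i) (f i)) (A i))" .
  qed
qed

text \<open>An affine substitution of slope -1 has Jacobian factor 1.\<close>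

lemma emeasure_lborel_reflect:
  fixes A :: "real set"
  assumes [measurable]: "A \<in> sets borel"
  shows "emeasure lborel ((\<lambda>x. 1 - x) -` A) = emeasure lborel A"
proof -
  have "lborel = distr lborel borel (\<lambda>x::real. 1 - x)"
    using lborel_real_affine[of "-1" 1] by (simp add: density_1 one_ennreal_def[symmetric])
  then have "emeasure lborel A = emeasure (distr lborel borel (\<lambda>x::real. 1 - x)) A" by simp
  also have "\<dots> = emeasure lborel ((\<lambda>x. 1 - x) -` A)"
    by (subst emeasure_distr) auto
  finally show ?thesis by simp
qed

lemma measurable_sigma_perm [measurable]:
  assumes "\<beta> \<in> perms d"
  shows "sigma_perm d \<beta> \<in> lebesgue_tuples d \<rightarrow>\<^sub>M lebesgue_tuples d"
  unfolding sigma_perm_def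
  by (rule measurable_restrict, rule measurable_component_singleton) (use perms_in[OF assms] in blast)

lemma measurable_tau_flip [measurable]:
  "tau_flip d \<alpha> \<in> lebesgue_tuples d \<rightarrow>\<^sub>M lebesgue_tuples d"
  unfolding tau_flip_def by measurable

lemma measurable_flip_perm:
  assumes "\<beta> \<in> perms d"
  shows "(\<lambda>u. sigma_perm d \<beta> (tau_flip d \<alpha> u)) \<in> lebesgue_tuples d \<rightarrow>\<^sub>M lebesgue_tuples d"
    and "(\<lambda>u. tau_flip d \<alpha> (sigma_perm d \<beta> u)) \<in> lebesgue_tuples d \<rightarrow>\<^sub>M lebesgue_tuples d"
  by (rule measurable_compose[OF measurable_tau_flip measurable_sigma_perm[OF assms]],
      rule measurable_compose[OF measurable_sigma_perm[OF assms] measurable_tau_flip])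

text \<open>The preimage of a box is again a box, whose sides are those of the first in permuted
  order, some of them reflected in 1/2. Reflection keeps each length and reordering keeps their
  product.\<close>

lemma distr_flip_perm:
  assumes a: "\<alpha> \<in> bits d" and b: "\<beta> \<in> perms d"
  shows "distr (lebesgue_tuples d) (lebesgue_tuples d) (\<lambda>u. sigma_perm d \<beta> (tau_flip d \<alpha> u)) = lebesgue_tuples d"
proof -
  interpret product_sigma_finite "\<lambda>_::nat. lborel :: real measure" by standard
  show ?thesis
  proof (rule PiM_eqI)
    fix A :: "nat \<Rightarrow> real set" assume "\<And>i. i \<in> {1..d} \<Longrightarrow> A i \<in> sets lborel"
    then have A[measurable]: "i \<in> {1..d} \<Longrightarrow> A i \<in> sets borel" for i by simp
    let ?fl = "\<lambda>i x. \<alpha> i * (1 - x) + (1 - \<alpha> i) * x"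
    \<comment> \<open>Coordinate \<open>i\<close> of \<open>u\<close> lands in position
      \<open>inv \<beta> i\<close>, which explains the index of the side.\<close>
    let ?B = "\<lambda>i. ?fl i -` A (inv \<beta> i)"
    have bi: "inv \<beta> i \<in> {1..d}" if "i \<in> {1..d}" for i
      using perms_in[OF inv_perms[OF b]] that by simp
    have B: "?B i \<in> sets borel" if "i \<in> {1..d}" for i
      using measurable_sets[of "?fl i" borel borel, OF _ A[OF bi[OF that]]] by simp
    have eq: "?B i = A (inv \<beta> i) \<or> ?B i = (\<lambda>x. 1 - x) -` A (inv \<beta> i)" if "i \<in> {1..d}" for i
      using bits_cases[OF a that] by auto
    have Bm: "emeasure lborel (?B i) = emeasure lborel (A (inv \<beta> i))" if "i \<in> {1..d}" for i
      using eq[OF that] emeasure_lborel_reflect[OF A[OF bi[OF that]]] by presburger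
    have "emeasure (distr (lebesgue_tuples d) (lebesgue_tuples d) (\<lambda>u. sigma_perm d \<beta> (tau_flip d \<alpha> u))) (Pi\<^sub>E {1..d} A)
      = emeasure (lebesgue_tuples d) ((\<lambda>u. sigma_perm d \<beta> (tau_flip d \<alpha> u)) -` (Pi\<^sub>E {1..d} A) \<inter> space (lebesgue_tuples d))"
      by (intro emeasure_distr measurable_flip_perm[OF b] sets_PiM_I_finite) auto
    also have "(\<lambda>u. sigma_perm d \<beta> (tau_flip d \<alpha> u)) -` (Pi\<^sub>E {1..d} A) \<inter> space (lebesgue_tuples d) = Pi\<^sub>E {1..d} ?B"
    proof (rule set_eqI)
      fix u
      have "(\<forall>i\<in>{1..d}. ?fl (\<beta> i) (u (\<beta> i)) \<in> A i) \<longleftrightarrow> (\<forall>i\<in>{1..d}. ?fl i (u i) \<in> A (inv \<beta> i))"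
        using perms_inv_apply[OF b] perms_in[OF b] bi by metis
      then show "u \<in> (\<lambda>u. sigma_perm d \<beta> (tau_flip d \<alpha> u)) -` (Pi\<^sub>E {1..d} A) \<inter> space (lebesgue_tuples d)
          \<longleftrightarrow> u \<in> Pi\<^sub>E {1..d} ?B"
        using perms_in[OF b]
        by (auto simp: space_PiM PiE_iff sigma_perm_def tau_flip_def simp del: One_nat_def atLeastAtMost_iff)
    qed
    also have "emeasure (lebesgue_tuples d) (Pi\<^sub>E {1..d} ?B) = (\<Prod>i\<in>{1..d}. emeasure lborel (A (inv \<beta> i)))"
      using B by (subst emeasure_PiM) (auto simp: Bm intro!: prod.cong)
    also have "\<dots> = (\<Prod>i\<in>{1..d}. emeasure lborel (A i))"
      using inv_perms[OF b] unfolding perms_def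
      by (intro prod.reindex_bij_betw permutes_imp_bij) auto
    finally show "emeasure (distr (lebesgue_tuples d) (lebesgue_tuples d) (\<lambda>u. sigma_perm d \<beta> (tau_flip d \<alpha> u))) (Pi\<^sub>E {1..d} A)
      = (\<Prod>i\<in>{1..d}. emeasure lborel (A i))" .
  qed auto
qed

lemma unit_cube_sets [measurable]: "unit_cube d \<in> sets (lebesgue_tuples d)"
  unfolding unit_cube_def by (intro sets_PiM_I_finite) auto

abbreviation cube_space :: "nat \<Rightarrow> (nat \<Rightarrow> real) measure" where
  "cube_space d \<equiv> restrict_space (lebesgue_tuples d) (unit_cube d)"

lemma space_cube_space: "space (cube_space d) = unit_cube d"
  using sets.sets_into_space[OF unit_cube_sets] by (auto simp: space_restrict_space)

lemma sets_cube_space_iff: "A \<in> sets (cube_space d) \<longleftrightarrow> A \<subseteq> unit_cube d \<and> A \<in> sets (lebesgue_tuples d)"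
  using space_cube_space[of d] by (subst sets_restrict_space_iff) (simp_all add: space_restrict_space)

lemma indicator_unit_cube:
  "u \<in> space (lebesgue_tuples d) \<Longrightarrow> indicator (unit_cube d) u = (\<Prod>i\<in>{1..d}. indicator {0..1} (u i) :: ennreal)"
  by (auto simp: indicator_def unit_cube_def space_PiM PiE_iff prod_zero_iff)

text \<open>The coordinatewise image of a product of probability laws is the product of the images,
  here of uniform laws, and that product is Lebesgue measure on the cube.\<close>

lemma distr_cdf_tuples:
  assumes \<mu>: "prob_space \<mu>" "sets \<mu> = sets borel"
    and \<Phi>: "distr \<mu> borel \<Phi> = uniform_measure lborel {0..1}" "\<Phi> \<in> borel_measurable borel" "range \<Phi> \<subseteq> {0..1}"
  shows "distr (Pi\<^sub>M {1..d} (\<lambda>_. \<mu>)) (cube_space d) (\<lambda>x. \<lambda>i\<in>{1..d}. \<Phi> (x i)) = cube_space d"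
proof -
  let ?T = "\<lambda>x. \<lambda>i\<in>{1..d}. \<Phi> (x i)"
  let ?U = "uniform_measure lborel {0..1::real}"
  let ?P = "Pi\<^sub>M {1..d} (\<lambda>_. \<mu>)"
  interpret \<mu>: prob_space \<mu> by fact
  have U: "?U = density lborel (indicator {0..1})"
    by (simp add: uniform_measure_def divide_ennreal_def)
  interpret U: prob_space ?U by (rule prob_space_uniform_measure) auto
  have \<Phi>m[measurable]: "\<Phi> \<in> borel_measurable \<mu>"
    using \<Phi>(2) by (simp add: measurable_cong_sets[OF \<mu>(2) refl])
  have T[measurable]: "?T \<in> ?P \<rightarrow>\<^sub>M lebesgue_tuples d"
    by measurable
  have TQ: "?T \<in> ?P \<rightarrow>\<^sub>M cube_space d"
    using \<Phi>(3) by (intro measurable_restrict_space2 T) (auto simp: unit_cube_def)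
  have sU: "sets (Pi\<^sub>M {1..d} (\<lambda>_. ?U)) = sets (lebesgue_tuples d)"
    by (rule sets_PiM_cong) auto
  have "distr ?P (Pi\<^sub>M {1..d} (\<lambda>_. ?U)) ?T = Pi\<^sub>M {1..d} (\<lambda>_. ?U)"
  proof -
    have "distr ?P (Pi\<^sub>M {1..d} (\<lambda>_. ?U)) (compose {1..d} \<Phi>) = Pi\<^sub>M {1..d} (\<lambda>_. distr \<mu> ?U \<Phi>)"
      by (rule distr_PiM_finite_prob_space') (auto intro: \<mu> U.prob_space_axioms)
    also have "distr \<mu> ?U \<Phi> = distr \<mu> borel \<Phi>" by (rule distr_cong) auto
    also have "compose {1..d} \<Phi> = ?T" by (simp add: compose_def fun_eq_iff)
    finally show ?thesis by (simp only: \<Phi>(1))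
  qed
  also have "\<dots> = density (lebesgue_tuples d) (\<lambda>x. \<Prod>i\<in>{1..d}. indicator {0..1} (x i))"
    unfolding U by (rule density_PiM[symmetric])
      (auto simp: U[symmetric] intro: lborel.sigma_finite_measure_axioms U.sigma_finite_measure_axioms)
  also have "\<dots> = density (lebesgue_tuples d) (indicator (unit_cube d))"
    by (intro density_cong) (auto simp: indicator_unit_cube)
  finally have D: "distr ?P (Pi\<^sub>M {1..d} (\<lambda>_. ?U)) ?T = density (lebesgue_tuples d) (indicator (unit_cube d))" .
  \<comment> \<open>The image was found as a measure on all tuples whose density is the indicator of
    the cube; on measurable subsets of the cube it agrees with the restricted measure.\<close>
  show ?thesis
  proof (rule measure_eqI)
    fix A assume "A \<in> sets (distr ?P (cube_space d) ?T)"
    then have AQ: "A \<in> sets (cube_space d)" by simp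
    then have A: "A \<subseteq> unit_cube d" "A \<in> sets (lebesgue_tuples d)"
      by (simp_all add: sets_cube_space_iff)
    have "emeasure (distr ?P (cube_space d) ?T) A = emeasure (distr ?P (Pi\<^sub>M {1..d} (\<lambda>_. ?U)) ?T) A"
      using AQ A TQ T by (simp add: emeasure_distr sU measurable_cong_sets[OF refl sU])
    also have "\<dots> = emeasure (lebesgue_tuples d) A"
      unfolding D using A by (simp add: emeasure_density indicator_inter_arith[symmetric] Int_absorb1)
    also have "\<dots> = emeasure (cube_space d) A"
      using A by (simp add: emeasure_restrict_space)
    finally show "emeasure (distr ?P (cube_space d) ?T) A = emeasure (cube_space d) A" .
  qed simp
qed

text \<open>Closed lower orthants are stable under intersection, generate the product sigma-algebra
  and exhaust the space along the corners \<open>(n, ..., n)\<close>. Thus a multivariate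
  distribution function determines the law.\<close>

lemma measure_eqI_orthants:
  fixes P N :: "('i \<Rightarrow> real) measure"
  assumes I: "finite I" and "finite_measure P"
    and sP: "sets P = sets (Pi\<^sub>M I (\<lambda>_. lborel))" and sN: "sets N = sets (Pi\<^sub>M I (\<lambda>_. lborel))"
    and eq: "\<And>a. emeasure P {x \<in> extensional I. \<forall>i\<in>I. x i \<le> a i} =
      emeasure N {x \<in> extensional I. \<forall>i\<in>I. x i \<le> a i}"
  shows "P = N"
proof -
  interpret finite_measure P by fact
  let ?O = "\<lambda>a. {x \<in> extensional I. \<forall>i\<in>I. x i \<le> (a i :: real)}"
  have gen: "sets (Pi\<^sub>M I (\<lambda>_. lborel :: real measure)) = sigma_sets (extensional I) (range ?O)"
  proof -
    have "sets (Pi\<^sub>M I (\<lambda>_. lborel :: real measure)) = sets (Pi\<^sub>M I (\<lambda>_. sigma UNIV (range (\<lambda>a::real. {..a}))))"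
      by (intro sets_PiM_cong) (simp_all add: borel_eq_atMost[symmetric])
    \<comment> \<open>The index set is covered by the single block \<open>I\<close>, so the
      generators are full boxes of half-lines, that is, orthants.\<close>
    also have "\<dots> = sets (sigma (\<Pi>\<^sub>E i\<in>I. UNIV)
        {{f\<in>(\<Pi>\<^sub>E i\<in>I. UNIV). \<forall>i\<in>j. f i \<in> A i} | A j. j \<in> {I} \<and> A \<in> Pi j (\<lambda>_. range (\<lambda>a::real. {..a}))})"
    proof (rule sets_PiM_sigma)
      have "(UNIV :: real set) = \<Union>(range (\<lambda>n. {..real n}))"
        using real_arch_simple by auto
      then show "\<exists>S\<subseteq>range (\<lambda>a::real. {..a}). countable S \<and> UNIV = \<Union>S"
        by (intro exI[of _ "range (\<lambda>n. {..real n})"]) auto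
    qed (use I in auto)
    also have "{{f\<in>(\<Pi>\<^sub>E i\<in>I. UNIV). \<forall>i\<in>j. f i \<in> A i} | A j. j \<in> {I} \<and> A \<in> Pi j (\<lambda>_. range (\<lambda>a::real. {..a}))} = range ?O"
    proof (intro set_eqI iffI)
      fix Z assume "Z \<in> {{f\<in>(\<Pi>\<^sub>E i\<in>I. UNIV). \<forall>i\<in>j. f i \<in> A i} | A j. j \<in> {I} \<and> A \<in> Pi j (\<lambda>_. range (\<lambda>a::real. {..a}))}"
      then obtain A where Z: "Z = {f\<in>(\<Pi>\<^sub>E i\<in>I. UNIV). \<forall>i\<in>I. f i \<in> A i}" and "A \<in> Pi I (\<lambda>_. range (\<lambda>a::real. {..a}))"
        by auto
      then have "\<forall>i\<in>I. \<exists>a. A i = {..a}" by auto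
      then obtain a where "\<forall>i\<in>I. A i = {..a i}" by metis
      then have "Z = ?O a" unfolding Z by (auto simp: PiE_def)
      then show "Z \<in> range ?O" by blast
    next
      fix Z assume "Z \<in> range ?O"
      then obtain a where "Z = ?O a" by blast
      then have "Z = {f\<in>(\<Pi>\<^sub>E i\<in>I. UNIV). \<forall>i\<in>I. f i \<in> {..a i}}" by (auto simp: PiE_def)
      then show "Z \<in> {{f\<in>(\<Pi>\<^sub>E i\<in>I. UNIV). \<forall>i\<in>j. f i \<in> A i} | A j. j \<in> {I} \<and> A \<in> Pi j (\<lambda>_. range (\<lambda>a::real. {..a}))}"
        by (intro CollectI exI[of _ "\<lambda>i. {..a i}"] exI[of _ I]) auto
    qed
    also have "(\<Pi>\<^sub>E i\<in>I. (UNIV :: real set)) = extensional I" by (auto simp: PiE_def)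
    finally show ?thesis by (simp add: sets_measure_of[of "range ?O"] image_subset_iff)
  qed
  show ?thesis
  proof (rule measure_eqI_generator_eq[where \<Omega> = "extensional I" and E = "range ?O" and A = "\<lambda>n. ?O (\<lambda>_. real n)"])
    show "Int_stable (range ?O)"
    proof (rule Int_stableI)
      fix a b assume "a \<in> range ?O" "b \<in> range ?O"
      then obtain s t where st: "a = ?O s" "b = ?O t" by blast
      have "a \<inter> b = ?O (\<lambda>i. min (s i) (t i))" unfolding st by auto
      then show "a \<inter> b \<in> range ?O" by (rule range_eqI[where x = "\<lambda>i. min (s i) (t i)"])
    qed
    show "range ?O \<subseteq> Pow (extensional I)" by auto
    show "emeasure P X = emeasure N X" if "X \<in> range ?O" for X
      using that eq by auto
    show "sets P = sigma_sets (extensional I) (range ?O)" "sets N = sigma_sets (extensional I) (range ?O)"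
      by (simp_all only: sP sN gen)
    show "range (\<lambda>n. ?O (\<lambda>_. real n)) \<subseteq> range ?O" by auto
    show "(\<Union>n. ?O (\<lambda>_. real n)) = extensional I"
    proof (intro equalityI subsetI)
      fix x :: "'i \<Rightarrow> real" assume x: "x \<in> extensional I"
      \<comment> \<open>One bound on the sum of absolute values bounds all coordinates
        simultaneously.\<close>
      obtain n where n: "(\<Sum>i\<in>I. \<bar>x i\<bar>) \<le> real n" using real_arch_simple by blast
      have "x i \<le> real n" if "i \<in> I" for i
        using member_le_sum[OF that, of "\<lambda>i. \<bar>x i\<bar>"] I n by force
      with x show "x \<in> (\<Union>n. ?O (\<lambda>_. real n))" by blast
    qed auto
    show "emeasure P (?O (\<lambda>_. real n)) \<noteq> \<infinity>" for n by simp
  qed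
qed

text \<open>The quantile function \<open>I\<close> carries the uniform law on the open unit interval
  to \<mu>. Continuity makes it a right inverse of the cdf, so the cdf carries \<mu> back to the
  uniform law; strict growth makes it a left inverse too.\<close>

lemma continuous_strict_mono_cdf:
  assumes \<mu>: "real_distribution \<mu>" and ccont: "continuous_on UNIV (cdf \<mu>)" and smono: "strict_mono (cdf \<mu>)"
  obtains \<Psi> :: "real \<Rightarrow> real"
  where "\<Psi> \<in> borel_measurable borel" "\<And>x. \<Psi> (cdf \<mu> x) = x"
    "distr \<mu> borel (cdf \<mu>) = uniform_measure lborel {0..1}" "cdf \<mu> \<in> borel_measurable borel" "range (cdf \<mu>) \<subseteq> {0..1}"
proof -
  interpret real_distribution \<mu> by fact
  interpret cdf_distribution \<mu> ..
  \<comment> \<open>Moving \<open>x\<close> by 1 either way still gives values in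
    \<open>[0, 1]\<close>, so strict growth excludes 0 and 1 themselves.\<close>
  have range: "0 < C x" "C x < 1" for x
    using strict_monoD[OF smono, of "x - 1" x] strict_monoD[OF smono, of x "x + 1"]
      cdf_nonneg[of "x - 1"] cdf_bounded_prob[of "x + 1"] by auto
  have CI: "C (I u) = u" if u: "0 < u" "u < 1" for u
  proof -
    obtain a where a: "C a < u"
      using order_tendstoD(2)[OF bot u(1)] by (auto simp: eventually_at_bot_linorder)
    obtain b where b: "u < C b"
      using order_tendstoD(1)[OF top u(2)] by (auto simp: eventually_at_top_linorder)
    have "a < b" using a b smono by (meson less_trans strict_mono_less)
    \<comment> \<open>Continuity enters here: the intermediate value theorem excludes a jump of the
      cdf over \<open>u\<close>.\<close>
    then obtain x where x: "C x = u"
      using IVT'[of C a u b] a b continuous_on_subset[OF ccont] by force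
    have "I u \<le> x" "u \<le> C (I u)" using pseudoinverse[OF u] x by blast+
    then show ?thesis using x smono by (metis order.antisym strict_mono_less_eq)
  qed
  \<comment> \<open>The default 0 makes the inverse total; the cdf takes values in the open
    interval, so \<open>\<Psi> (C x)\<close> never meets it.\<close>
  define \<Psi> where "\<Psi> = (\<lambda>u. if u \<in> {0<..<1} then I u else 0)"
  show thesis
  proof
    show "\<Psi> \<in> borel_measurable borel"
      unfolding \<Psi>_def using measurable_CI by (subst (asm) measurable_restrict_space_iff) auto
    show "\<Psi> (C x) = x" for x
      using range[of x] CI[of "C x"] strict_mono_eq[OF smono] by (simp add: \<Psi>_def)
    show "distr \<mu> borel C = uniform_measure lborel {0..1}"
    proof -
      let ?V = "restrict_space lborel {0<..<1::real}"
      have "distr \<mu> borel C = distr (distr ?V borel I) borel C" by (simp only: distr_I_eq_M)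
      also have "\<dots> = distr ?V borel (C \<circ> I)"
        using measurable_CI by (intro distr_distr measurable_C) (simp cong: measurable_cong_sets)
      also have "\<dots> = distr ?V borel (\<lambda>u. u)"
        using CI by (intro distr_cong refl) (simp add: space_restrict_space)
      also have "\<dots> = uniform_measure lborel {0..1}"
      proof (rule measure_eqI)
        fix A assume "A \<in> sets (distr ?V borel (\<lambda>u. u))"
        then have A[measurable]: "A \<in> sets borel" by simp
        have "emeasure (distr ?V borel (\<lambda>u. u)) A = emeasure ?V (A \<inter> {0<..<1})"
          by (subst emeasure_distr) (auto intro!: measurable_restrict_space1 simp: space_restrict_space)
        also have "\<dots> = emeasure lborel (A \<inter> {0<..<1})" by (intro emeasure_restrict_space) auto
        also have "\<dots> = emeasure lborel ({0..1} \<inter> A)"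
        proof (rule emeasure_eq_AE)
          \<comment> \<open>The open and the closed interval differ by two points, a null
            set.\<close>
          show "AE x in lborel. x \<in> A \<inter> {0<..<1} \<longleftrightarrow> x \<in> {0..1} \<inter> A"
            using AE_lborel_singleton[of 0] AE_lborel_singleton[of 1] by eventually_elim auto
        qed auto
        also have "\<dots> = emeasure (uniform_measure lborel {0..1}) A"
          by (simp add: divide_ennreal_def)
        finally show "emeasure (distr ?V borel (\<lambda>u. u)) A = emeasure (uniform_measure lborel {0..1}) A" .
      qed simp
      finally show ?thesis .
    qed
    show "C \<in> borel_measurable borel" by (rule measurable_C)
    show "range C \<subseteq> {0..1}" using range by (force intro: less_imp_le)
  qed
qed

section \<open>The perturbed copula density\<close>

text \<open>The substitution \<open>v = sigma_perm d \<beta> (tau_flip d \<alpha> u)\<close> is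
  legitimate because this map preserves Lebesgue measure; in the new variable the indicator of
  \<open>A\<close> is taken at the inverse image of \<open>v\<close>.\<close>

lemma integral_flip_perm:
  fixes w :: "(nat \<Rightarrow> real) \<Rightarrow> real"
  assumes a: "\<alpha> \<in> bits d" and b: "\<beta> \<in> perms d"
    and w: "integrable (lebesgue_tuples d) w" and A[measurable]: "A \<in> sets (lebesgue_tuples d)"
  shows "integrable (lebesgue_tuples d) (\<lambda>u. indicator A u * w (sigma_perm d \<beta> (tau_flip d \<alpha> u)))"
    and "integrable (lebesgue_tuples d) (\<lambda>v. indicator A (tau_flip d \<alpha> (sigma_perm d (inv \<beta>) v)) * w v)"
    and "(\<integral>u. indicator A u * w (sigma_perm d \<beta> (tau_flip d \<alpha> u)) \<partial>lebesgue_tuples d) =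
      (\<integral>v. indicator A (tau_flip d \<alpha> (sigma_perm d (inv \<beta>) v)) * w v \<partial>lebesgue_tuples d)"
proof -
  let ?L = "lebesgue_tuples d"
  let ?P = "\<lambda>u. sigma_perm d \<beta> (tau_flip d \<alpha> u)"
  let ?P' = "\<lambda>v. tau_flip d \<alpha> (sigma_perm d (inv \<beta>) v)"
  let ?G = "\<lambda>v. indicator A (?P' v) * w v"
  have P: "?P \<in> ?L \<rightarrow>\<^sub>M ?L" by (rule measurable_flip_perm[OF b])
  have P': "?P' \<in> ?L \<rightarrow>\<^sub>M ?L" by (rule measurable_flip_perm[OF inv_perms[OF b]])
  have "integrable ?L (\<lambda>v. w v * indicator (?P' -` A \<inter> space ?L) v)"
    using w measurable_sets[OF P' A] by (rule integrable_real_mult_indicator[rotated])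
  then show G: "integrable ?L ?G"
    by (rule Bochner_Integration.integrable_cong[THEN iffD1, OF refl, rotated]) (auto simp: indicator_def)
  have Gm: "?G \<in> borel_measurable ?L" using G by auto
  have eq: "?G (?P u) = indicator A u * w (?P u)" if "u \<in> space ?L" for u
    using that flip_perm_inverse[OF a b, of u] by (auto simp: space_PiM PiE_iff)
  have "integrable ?L (\<lambda>u. ?G (?P u))"
    using G by (subst (asm) distr_flip_perm[OF a b, symmetric]) (simp only: integrable_distr_eq[OF P Gm])
  then show "integrable ?L (\<lambda>u. indicator A u * w (?P u))"
    by (rule Bochner_Integration.integrable_cong[THEN iffD1, OF refl, rotated]) (rule eq)
  have "(\<integral>v. ?G v \<partial>?L) = (\<integral>v. ?G v \<partial>distr ?L ?L ?P)"
    by (simp only: distr_flip_perm[OF a b])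
  also have "\<dots> = (\<integral>u. ?G (?P u) \<partial>?L)"
    by (rule integral_distr[OF P Gm])
  also have "\<dots> = (\<integral>u. indicator A u * w (?P u) \<partial>?L)"
    by (rule Bochner_Integration.integral_cong) (auto simp only: eq)
  finally show "(\<integral>u. indicator A u * w (?P u) \<partial>?L) = (\<integral>v. ?G v \<partial>?L)" ..
qed

text \<open>Inside the cube, membership in \<open>Delta d \<alpha> \<beta>\<close> depends on the
  transformed tuple alone. Each summand thus becomes a multiple of one fixed function, \<gamma> cut
  off to \<open>Delta0 d\<close>, composed with a measure-preserving map.\<close>

lemma theta_unit_cube:
  assumes "u \<in> unit_cube d"
  shows "theta d c \<epsilon> \<gamma> u = c u - (\<Sum>(\<alpha>, \<beta>)\<in>bits d \<times> perms d.
    \<epsilon> (\<alpha>, \<beta>) * (indicator (Delta0 d) (sigma_perm d \<beta> (tau_flip d \<alpha> u)) * \<gamma> (sigma_perm d \<beta> (tau_flip d \<alpha> u))))"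
  using assms unfolding theta_def
  by (intro arg_cong2[where f = minus] sum.cong refl) (auto simp: Delta_def indicator_def)

text \<open>At most one summand is nonzero at \<open>u\<close>. If its coefficient is positive, the
  bound on \<gamma> applies at the transformed point, which the inverse map takes back to
  \<open>u\<close>; otherwise the summand is at most 0, hence at most \<open>c u\<close>.\<close>

lemma theta_nonneg:
  assumes c: "\<forall>u\<in>unit_cube d. 0 \<le> c u" and \<gamma>: "\<forall>u\<in>Delta0 d. 0 \<le> \<gamma> u"
    and bound: "\<And>u \<alpha> \<beta>. u \<in> Delta0 d \<Longrightarrow> \<alpha> \<in> bits d \<Longrightarrow> \<beta> \<in> perms d \<Longrightarrow> \<epsilon> (\<alpha>, \<beta>) > 0 \<Longrightarrow>
      \<gamma> u \<le> c (tau_flip d \<alpha> (sigma_perm d (inv \<beta>) u)) / \<epsilon> (\<alpha>, \<beta>)"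
    and u: "u \<in> unit_cube d"
  shows "0 \<le> theta d c \<epsilon> \<gamma> u"
proof -
  let ?P = "\<lambda>\<alpha> \<beta>. sigma_perm d \<beta> (tau_flip d \<alpha> u)"
  let ?t = "\<lambda>(\<alpha>, \<beta>). \<epsilon> (\<alpha>, \<beta>) * (indicator (Delta0 d) (?P \<alpha> \<beta>) * \<gamma> (?P \<alpha> \<beta>))"
  have cu: "0 \<le> c u" using c u by blast
  have ext: "u \<in> extensional {1..d}" using u by (auto simp: unit_cube_def PiE_iff)
  have "(\<Sum>p\<in>bits d \<times> perms d. ?t p) \<le> c u"
  proof (cases "\<exists>\<alpha>\<in>bits d. \<exists>\<beta>\<in>perms d. ?P \<alpha> \<beta> \<in> Delta0 d")
    case False
    then have "(\<Sum>p\<in>bits d \<times> perms d. ?t p) = 0" by (intro sum.neutral) auto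
    with cu show ?thesis by simp
  next
    case True
    then obtain \<alpha> \<beta> where ab: "\<alpha> \<in> bits d" "\<beta> \<in> perms d" "?P \<alpha> \<beta> \<in> Delta0 d" by blast
    \<comment> \<open>A second nonzero summand would put \<open>u\<close> into two of the disjoint
      simplices.\<close>
    have "?t p = 0" if "p \<in> bits d \<times> perms d - {(\<alpha>, \<beta>)}" for p
      using that flip_perm_Delta0_unique[OF ab(1) _ ab(2) _ ab(3)] by (cases p) (auto simp: indicator_def)
    then have "(\<Sum>p\<in>bits d \<times> perms d. ?t p) = (\<Sum>p\<in>{(\<alpha>, \<beta>)}. ?t p)"
      using ab by (intro sum.mono_neutral_right) (auto simp: finite_bits finite_perms)
    also have "\<dots> = \<epsilon> (\<alpha>, \<beta>) * \<gamma> (?P \<alpha> \<beta>)" using ab(3) by simp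
    also have "\<dots> \<le> c u"
    proof (cases "\<epsilon> (\<alpha>, \<beta>) > 0")
      case True
      then show ?thesis
        using bound[OF ab(3,1,2) True] flip_perm_inverse[OF ab(1,2) ext]
        by (simp add: field_simps)
    next
      case False
      moreover have "0 \<le> \<gamma> (?P \<alpha> \<beta>)" using \<gamma> ab(3) by blast
      ultimately show ?thesis using cu mult_nonpos_nonneg[of "\<epsilon> (\<alpha>, \<beta>)" "\<gamma> (?P \<alpha> \<beta>)"] by linarith
    qed
    finally show ?thesis .
  qed
  then show ?thesis by (simp add: theta_unit_cube[OF u])
qed

text \<open>Integrability of \<gamma> on \<open>Delta0 d\<close> gives measurability of the cut-off
  function, hence the passage through \<open>theta_unit_cube\<close>.\<close>

lemma theta_measurable:
  assumes c: "c \<in> borel_measurable (cube_space d)"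
    and \<gamma>: "set_integrable (lebesgue_tuples d) (Delta0 d) \<gamma>"
  shows "theta d c \<epsilon> \<gamma> \<in> borel_measurable (cube_space d)"
proof -
  let ?w = "\<lambda>v. indicator (Delta0 d) v * \<gamma> v"
  have w: "?w \<in> borel_measurable (lebesgue_tuples d)"
    using \<gamma> by (auto simp: set_integrable_def)
  have "(\<lambda>u. c u - (\<Sum>(\<alpha>, \<beta>)\<in>bits d \<times> perms d. \<epsilon> (\<alpha>, \<beta>) * ?w (sigma_perm d \<beta> (tau_flip d \<alpha> u))))
      \<in> borel_measurable (cube_space d)"
  proof (intro borel_measurable_diff c borel_measurable_sum)
    fix p assume "p \<in> bits d \<times> perms d"
    then obtain \<alpha> \<beta> where p: "p = (\<alpha>, \<beta>)" "\<beta> \<in> perms d" by blast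
    have "(\<lambda>u. ?w (sigma_perm d \<beta> (tau_flip d \<alpha> u))) \<in> borel_measurable (lebesgue_tuples d)"
      by (rule measurable_compose[OF measurable_flip_perm(1)[OF p(2)] w])
    then show "(\<lambda>u. case p of (\<alpha>, \<beta>) \<Rightarrow> \<epsilon> (\<alpha>, \<beta>) * ?w (sigma_perm d \<beta> (tau_flip d \<alpha> u))) \<in> borel_measurable (cube_space d)"
      unfolding p by (auto intro: measurable_restrict_space1)
  qed
  then show ?thesis
    by (rule measurable_cong[THEN iffD1, rotated -1]) (simp only: theta_unit_cube space_cube_space)
qed

text \<open>The indicator of \<open>A\<close> vanishes off the cube, so the integral may run over
  all tuples, where Lebesgue measure is invariant under flips and permutations.\<close>

lemma emeasure_cube_measure:
  assumes h: "h \<in> borel_measurable (cube_space d)" and A: "A \<in> sets (cube_space d)"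
  shows "emeasure (cube_measure d h) A = (\<integral>\<^sup>+u. ennreal (indicator A u * h u) \<partial>lebesgue_tuples d)"
proof -
  have A': "A \<subseteq> unit_cube d" using A by (simp_all add: sets_cube_space_iff)
  have "emeasure (cube_measure d h) A = (\<integral>\<^sup>+u. ennreal (h u) * indicator A u \<partial>cube_space d)"
    unfolding cube_measure_def using h A by (intro emeasure_density) auto
  also have "\<dots> = (\<integral>\<^sup>+u. ennreal (h u) * indicator A u * indicator (unit_cube d) u \<partial>lebesgue_tuples d)"
    by (rule nn_integral_restrict_space) simp
  also have "\<dots> = (\<integral>\<^sup>+u. ennreal (indicator A u * h u) \<partial>lebesgue_tuples d)"
    using A' by (intro nn_integral_cong) (auto simp: indicator_def)
  finally show ?thesis .
qed

text \<open>The two masses differ by the integrals of the perturbation summands over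
  \<open>A\<close>. Changing variables in each gathers them into one integral over
  \<open>Delta0 d\<close>, whose integrand has the sum in \<open>cancel\<close> as a factor.
  Integrals are real-valued because the coefficients change sign; non-negativity of both densities
  leads back to \<open>emeasure\<close>.\<close>

lemma emeasure_cube_measure_theta:
  assumes c: "copula_density d c"
    and \<gamma>: "set_integrable (lebesgue_tuples d) (Delta0 d) \<gamma>"
    and \<theta>: "\<And>u. u \<in> unit_cube d \<Longrightarrow> 0 \<le> theta d c \<epsilon> \<gamma> u"
    and A: "A \<in> sets (cube_space d)"
    and cancel: "\<And>v. v \<in> Delta0 d \<Longrightarrow> (\<Sum>(\<alpha>, \<beta>)\<in>bits d \<times> perms d.
      \<epsilon> (\<alpha>, \<beta>) * indicator A (tau_flip d \<alpha> (sigma_perm d (inv \<beta>) v))) = 0"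
  shows "emeasure (cube_measure d (theta d c \<epsilon> \<gamma>)) A = emeasure (cube_measure d c) A"
proof -
  let ?L = "lebesgue_tuples d" and ?S = "bits d \<times> perms d"
  let ?w = "\<lambda>v. indicator (Delta0 d) v * \<gamma> v"
  let ?P = "\<lambda>\<alpha> \<beta> u. sigma_perm d \<beta> (tau_flip d \<alpha> u)"
  let ?P' = "\<lambda>\<alpha> \<beta> v. tau_flip d \<alpha> (sigma_perm d (inv \<beta>) v)"
  have cm: "c \<in> borel_measurable (cube_space d)" and c0: "\<And>u. u \<in> unit_cube d \<Longrightarrow> 0 \<le> c u"
    and pr: "prob_space (cube_measure d c)"
    using c by (auto simp: copula_density_def)
  have A': "A \<subseteq> unit_cube d" "A \<in> sets ?L" using A by (simp_all add: sets_cube_space_iff)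
  have w: "integrable ?L ?w" using \<gamma> by (simp add: set_integrable_def)
  \<comment> \<open>\<open>c\<close> is measurable on the cube; multiplied by the indicator of
    \<open>A\<close> it extends by zero to all tuples.\<close>
  have cA: "(\<lambda>u. indicator A u * c u) \<in> borel_measurable ?L"
  proof -
    have "(\<lambda>u. indicator A u * c u) \<in> borel_measurable (cube_space d)"
      using cm A by simp
    then have "(\<lambda>u. indicator (unit_cube d) u *\<^sub>R (indicator A u * c u)) \<in> borel_measurable ?L"
      by (subst (asm) borel_measurable_restrict_space_iff) simp_all
    moreover have "indicator (unit_cube d) u *\<^sub>R (indicator A u * c u) = indicator A u * c u" for u
      using A' by (auto simp: indicator_def)
    ultimately show ?thesis by (simp only:)
  qed
  have c_nonneg: "0 \<le> indicator A u * c u" for u using A' c0 by (auto simp: indicator_def)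
  \<comment> \<open>The measure with density \<open>c\<close> is a probability, so it gives
    \<open>A\<close> finite mass.\<close>
  have ci: "integrable ?L (\<lambda>u. indicator A u * c u)"
  proof (rule integrableI_nonneg[OF cA])
    interpret prob_space "cube_measure d c" by (rule pr)
    show "(\<integral>\<^sup>+u. ennreal (indicator A u * c u) \<partial>?L) < \<infinity>"
      by (simp add: emeasure_cube_measure[OF cm A, symmetric] less_top[symmetric])
  qed (simp add: c_nonneg)
  have sum_eq: "indicator A u * theta d c \<epsilon> \<gamma> u = indicator A u * c u -
      (\<Sum>p\<in>?S. \<epsilon> p * (indicator A u * ?w (?P (fst p) (snd p) u)))" for u
    using A' by (auto simp: indicator_def[of A] theta_unit_cube case_prod_unfold)
  note i = integral_flip_perm[OF _ _ w A'(2)]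
  have si: "integrable ?L (\<lambda>u. \<Sum>p\<in>?S. \<epsilon> p * (indicator A u * ?w (?P (fst p) (snd p) u)))"
    by (intro Bochner_Integration.integrable_sum integrable_mult_right i(1)) auto
  have \<theta>i: "integrable ?L (\<lambda>u. indicator A u * theta d c \<epsilon> \<gamma> u)"
    unfolding sum_eq by (intro Bochner_Integration.integrable_diff ci si)
  have "(\<integral>u. (\<Sum>p\<in>?S. \<epsilon> p * (indicator A u * ?w (?P (fst p) (snd p) u))) \<partial>?L) =
      (\<Sum>p\<in>?S. \<epsilon> p * (\<integral>u. indicator A u * ?w (?P (fst p) (snd p) u) \<partial>?L))"
    by (subst Bochner_Integration.integral_sum) (auto intro!: integrable_mult_right i(1))
  also have "\<dots> = (\<Sum>p\<in>?S. \<epsilon> p * (\<integral>v. indicator A (?P' (fst p) (snd p) v) * ?w v \<partial>?L))"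
    by (intro sum.cong refl arg_cong2[where f = times] i(3)) auto
  also have "\<dots> = (\<integral>v. (\<Sum>p\<in>?S. \<epsilon> p * (indicator A (?P' (fst p) (snd p) v) * ?w v)) \<partial>?L)"
    by (subst Bochner_Integration.integral_sum) (auto intro!: integrable_mult_right i(2))
  also have "\<dots> = (\<integral>v. 0 \<partial>?L)"
  proof (rule Bochner_Integration.integral_cong[OF refl])
    fix v
    have "(\<Sum>p\<in>?S. \<epsilon> p * (indicator A (?P' (fst p) (snd p) v) * ?w v)) =
        (\<Sum>p\<in>?S. \<epsilon> p * indicator A (?P' (fst p) (snd p) v)) * ?w v"
      by (simp add: sum_distrib_right mult.assoc)
    \<comment> \<open>Off \<open>Delta0 d\<close> the cut-off \<gamma> is 0; on it the coefficient
      sum is.\<close>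
    also have "\<dots> = 0"
      using cancel[of v] by (cases "v \<in> Delta0 d") (auto simp: case_prod_unfold)
    finally show "(\<Sum>p\<in>?S. \<epsilon> p * (indicator A (?P' (fst p) (snd p) v) * ?w v)) = 0" .
  qed
  finally have z: "(\<integral>u. (\<Sum>p\<in>?S. \<epsilon> p * (indicator A u * ?w (?P (fst p) (snd p) u))) \<partial>?L) = 0" by simp
  have "emeasure (cube_measure d (theta d c \<epsilon> \<gamma>)) A = (\<integral>\<^sup>+u. ennreal (indicator A u * theta d c \<epsilon> \<gamma> u) \<partial>?L)"
    by (rule emeasure_cube_measure[OF theta_measurable[OF cm \<gamma>] A])
  also have "\<dots> = ennreal (\<integral>u. indicator A u * theta d c \<epsilon> \<gamma> u \<partial>?L)"
    using A' \<theta> by (intro nn_integral_eq_integral \<theta>i AE_I2) (auto simp: indicator_def)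
  also have "(\<integral>u. indicator A u * theta d c \<epsilon> \<gamma> u \<partial>?L) = (\<integral>u. indicator A u * c u \<partial>?L)"
    unfolding sum_eq by (subst Bochner_Integration.integral_diff[OF ci si]) (simp only: z diff_zero)
  also have "ennreal \<dots> = (\<integral>\<^sup>+u. ennreal (indicator A u * c u) \<partial>?L)"
    by (intro nn_integral_eq_integral[symmetric] ci AE_I2 c_nonneg)
  also have "\<dots> = emeasure (cube_measure d c) A"
    by (rule emeasure_cube_measure[OF cm A, symmetric])
  finally show ?thesis .
qed

section \<open>Transfer to general margins\<close>

lemma joint_density_measurable:
  assumes \<Phi>: "\<Phi> \<in> borel_measurable borel" "range \<Phi> \<subseteq> {0..1}" and \<phi>: "\<phi> \<in> borel_measurable borel"
    and h: "h \<in> borel_measurable (cube_space d)"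
  shows "(\<lambda>x. \<lambda>i\<in>{1..d}. \<Phi> (x i)) \<in> lebesgue_tuples d \<rightarrow>\<^sub>M cube_space d"
    and "joint_density d h \<Phi> \<phi> \<in> borel_measurable (lebesgue_tuples d)"
proof -
  have comp: "(\<lambda>x. f (x i)) \<in> borel_measurable (lebesgue_tuples d)"
    if "f \<in> borel_measurable borel" "i \<in> {1..d}" for f :: "real \<Rightarrow> real" and i
    using measurable_compose[OF measurable_component_singleton[OF that(2), of "\<lambda>_. lborel"]] that(1) by simp
  have "(\<lambda>x. \<lambda>i\<in>{1..d}. \<Phi> (x i)) \<in> lebesgue_tuples d \<rightarrow>\<^sub>M lebesgue_tuples d"
    using comp[OF \<Phi>(1)] by (intro measurable_restrict) simp
  then show T: "(\<lambda>x. \<lambda>i\<in>{1..d}. \<Phi> (x i)) \<in> lebesgue_tuples d \<rightarrow>\<^sub>M cube_space d"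
    using \<Phi>(2) by (intro measurable_restrict_space2) (auto simp: unit_cube_def)
  show "joint_density d h \<Phi> \<phi> \<in> borel_measurable (lebesgue_tuples d)"
    unfolding joint_density_def[abs_def]
    by (intro borel_measurable_times measurable_compose[OF T h] borel_measurable_prod comp \<phi>)
qed

text \<open>With respect to the product of the margins \<mu>, the joint density is \<open>h\<close>
  composed with the coordinatewise map \<Phi>, and this map carries that product to Lebesgue measure
  on the cube.\<close>

lemma distr_density_joint_density:
  assumes \<mu>: "prob_space \<mu>" "\<mu> = density lborel (\<lambda>t. ennreal (\<phi> t))"
    and \<phi>: "\<phi> \<in> borel_measurable borel" "\<forall>t. 0 \<le> \<phi> t"
    and \<Phi>: "distr \<mu> borel \<Phi> = uniform_measure lborel {0..1}" "\<Phi> \<in> borel_measurable borel" "range \<Phi> \<subseteq> {0..1}"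
    and h: "h \<in> borel_measurable (cube_space d)"
  shows "distr (density (lebesgue_tuples d) (\<lambda>x. ennreal (joint_density d h \<Phi> \<phi> x))) (cube_space d)
    (\<lambda>x. \<lambda>i\<in>{1..d}. \<Phi> (x i)) = cube_measure d h"
proof -
  let ?T = "\<lambda>x. \<lambda>i\<in>{1..d}. \<Phi> (x i)"
  let ?P = "Pi\<^sub>M {1..d} (\<lambda>_. \<mu>)"
  interpret \<mu>: prob_space \<mu> by fact
  note m = joint_density_measurable[OF \<Phi>(2,3) \<phi>(1) h]
  have \<phi>': "(\<lambda>t. ennreal (\<phi> t)) \<in> borel_measurable lborel" using \<phi>(1) by simp
  have s: "sets \<mu> = sets borel" by (simp add: \<mu>(2))
  have sP: "sets ?P = sets (lebesgue_tuples d)" by (rule sets_PiM_cong) (auto simp: s)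
  have P: "?P = density (lebesgue_tuples d) (\<lambda>x. \<Prod>i\<in>{1..d}. ennreal (\<phi> (x i)))"
    using density_PiM[of "{1..d}" "\<lambda>_. lborel" "\<lambda>_ t. ennreal (\<phi> t)"] \<phi>' \<mu>.sigma_finite_measure_axioms
    by (simp add: \<mu>(2) lborel.sigma_finite_measure_axioms)
  have Tm: "?T \<in> ?P \<rightarrow>\<^sub>M cube_space d" using m(1) by (simp add: measurable_cong_sets[OF sP refl])
  have \<phi>m: "(\<lambda>x. ennreal (\<phi> (x i))) \<in> borel_measurable (lebesgue_tuples d)" if "i \<in> {1..d}" for i
    by (rule measurable_compose[OF measurable_component_singleton[OF that] \<phi>'])
  have "density ?P (\<lambda>x. ennreal (h (?T x))) =
      density (lebesgue_tuples d) (\<lambda>x. (\<Prod>i\<in>{1..d}. ennreal (\<phi> (x i))) * ennreal (h (?T x)))"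
    unfolding P
    by (intro density_density_eq borel_measurable_prod_ennreal \<phi>m measurable_compose[OF measurable_compose[OF m(1) h]]) simp_all
  \<comment> \<open>The product of the values of \<phi> is non-negative, so \<open>ennreal\<close>
    splits it off whatever the sign of \<open>h\<close>.\<close>
  also have "\<dots> = density (lebesgue_tuples d) (\<lambda>x. ennreal (joint_density d h \<Phi> \<phi> x))"
    using \<phi>(2) by (intro arg_cong[where f = "density _"] ext)
      (simp add: joint_density_def prod_ennreal ennreal_mult' prod_nonneg mult.commute[of "h _"])
  finally have D: "density ?P (\<lambda>x. ennreal (h (?T x))) = density (lebesgue_tuples d) (\<lambda>x. ennreal (joint_density d h \<Phi> \<phi> x))" .
  have "cube_measure d h = density (distr ?P (cube_space d) ?T) (\<lambda>u. ennreal (h u))"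
    unfolding cube_measure_def distr_cdf_tuples[OF \<mu>(1) s \<Phi>] ..
  also have "\<dots> = distr (density ?P (\<lambda>x. ennreal (h (?T x)))) (cube_space d) ?T"
    using h by (intro density_distr Tm) simp
  finally show ?thesis by (simp only: D)
qed

theorem proposition6:
  fixes d :: nat and M :: "'a measure" and X :: "'a \<Rightarrow> nat \<Rightarrow> real"
    and c \<gamma> :: "(nat \<Rightarrow> real) \<Rightarrow> real"
    and \<mu> :: "real measure" and \<Phi> \<phi> :: "real \<Rightarrow> real"
    and \<epsilon> :: "(nat \<Rightarrow> real) \<times> (nat \<Rightarrow> nat) \<Rightarrow> real"
  assumes "2 \<le> d"
    and "prob_space M"
    and "X \<in> measurable M (lebesgue_tuples d)"
    and "\<forall>k\<in>{1..d}. distr M borel (\<lambda>w. X w k) = \<mu>"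
    and "has_copula_density M d X c"
    and "\<Phi> = cdf \<mu>" and "continuous_on UNIV \<Phi>" and "strict_mono \<Phi>"
    and "\<phi> \<in> borel_measurable borel" and "\<forall>t. 0 \<le> \<phi> t"
    and "\<mu> = density lborel (\<lambda>t. ennreal (\<phi> t))"
    and "set_integrable (lebesgue_tuples d) (Delta0 d) \<gamma>"
    and "\<forall>u\<in>Delta0 d. 0 \<le> \<gamma> u"
    and "\<epsilon> \<in> bits d \<times> perms d \<rightarrow> {-1..1}"
    and "\<forall>u\<in>Delta0 d. ereal (\<gamma> u) \<le>
           (INF (\<alpha>, \<beta>)\<in>{(\<alpha>, \<beta>). \<alpha> \<in> bits d \<and> \<beta> \<in> perms d \<and> \<epsilon> (\<alpha>, \<beta>) > 0}.
              ereal (c (tau_flip d \<alpha> (sigma_perm d (inv \<beta>) u)) / \<epsilon> (\<alpha>, \<beta>)))"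
    and "\<forall>\<alpha>\<in>bits d. (\<Sum>\<beta>\<in>perms d. \<epsilon> (sigma_perm d (inv \<beta>) \<alpha>, \<beta>)) = 0"
    and "\<forall>j\<in>{1..d}. \<forall>k\<in>{1..d}.
           (\<Sum>(a, b)\<in>bits (d - 1) \<times> perms (d - 1).
              \<epsilon> (omega_insert d k a 0, chi_insert j b k)) = 0 \<and>
           (\<Sum>(a, b)\<in>bits (d - 1) \<times> perms (d - 1).
              \<epsilon> (omega_insert d k a 1, chi_insert j b k)) = 0"
  shows "has_density M d X (joint_density d c \<Phi> \<phi>) \<and>
    (\<exists>(N :: (nat \<Rightarrow> real) measure) Y.
       prob_space N \<and>
       has_density N d Y (joint_density d (theta d c \<epsilon> \<gamma>) \<Phi> \<phi>) \<and>
       (\<forall>k\<in>{1..d}. distr N borel (\<lambda>w. Y w k) = distr M borel (\<lambda>w. X w k)) \<and>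
       (\<forall>(E :: 'b measure) g. g \<in> measurable (lebesgue_tuples d) E \<and> symmetric_on_tuples d g \<longrightarrow>
          distr N E (\<lambda>w. g (Y w)) = distr M E (\<lambda>w. g (X w))))"
proof -
  note d = assms(1) and Xm = assms(3) and marg = assms(4) and \<Phi>_def = assms(6)
    and \<phi> = assms(9,10) and \<mu>_eq = assms(11) and \<gamma>i = assms(12) and \<gamma>0 = assms(13)
  let ?L = "lebesgue_tuples d" and ?T = "\<lambda>x. \<lambda>i\<in>{1..d}. \<Phi> (x i)" and ?\<theta> = "theta d c \<epsilon> \<gamma>"
  let ?D = "\<lambda>h. density ?L (\<lambda>x. ennreal (joint_density d h \<Phi> \<phi> x))"
  interpret M: prob_space M by (rule assms(2))

  \<comment> \<open>Measurability and sign of the two cube densities\<close>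
  have copc: "copula_density d c" using assms(5) by (simp add: has_copula_density_def)
  then have cm: "c \<in> borel_measurable (cube_space d)" and c0: "\<forall>u\<in>unit_cube d. 0 \<le> c u"
    by (auto simp: copula_density_def)
  have \<theta>m: "?\<theta> \<in> borel_measurable (cube_space d)" by (rule theta_measurable[OF cm \<gamma>i])
  have \<theta>0: "\<forall>u\<in>unit_cube d. 0 \<le> ?\<theta> u"
  proof (intro ballI theta_nonneg[OF c0 \<gamma>0])
    fix u \<alpha> \<beta> assume u: "u \<in> Delta0 d" and ab: "\<alpha> \<in> bits d" "\<beta> \<in> perms d" "\<epsilon> (\<alpha>, \<beta>) > 0"
    have "ereal (\<gamma> u) \<le> (INF (\<alpha>, \<beta>)\<in>{(\<alpha>, \<beta>). \<alpha> \<in> bits d \<and> \<beta> \<in> perms d \<and> \<epsilon> (\<alpha>, \<beta>) > 0}.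
              ereal (c (tau_flip d \<alpha> (sigma_perm d (inv \<beta>) u)) / \<epsilon> (\<alpha>, \<beta>)))"
      using assms(15) u by blast
    \<comment> \<open>An infimum lies below each of its members, so every pair with positive
      coefficient yields its own bound.\<close>
    also have "\<dots> \<le> ereal (c (tau_flip d \<alpha> (sigma_perm d (inv \<beta>) u)) / \<epsilon> (\<alpha>, \<beta>))"
      using ab by (intro INF_lower2[of "(\<alpha>, \<beta>)"]) auto
    finally show "\<gamma> u \<le> c (tau_flip d \<alpha> (sigma_perm d (inv \<beta>) u)) / \<epsilon> (\<alpha>, \<beta>)" by simp
  qed

  \<comment> \<open>The common margin and its distribution function\<close>
  have Xk: "(\<lambda>w. X w k) \<in> borel_measurable M" if "k \<in> {1..d}" for k
    using measurable_compose[OF Xm measurable_component_singleton[OF that]] by simp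
  have one: "1 \<in> {1..d}" using d by simp
  have \<mu>: "real_distribution \<mu>"
    using M.prob_space_distr[OF Xk[OF one]] marg one
    by (metis real_distribution.intro real_distribution_axioms.intro sets_distr)
  then have \<mu>p: "prob_space \<mu>" by (simp add: real_distribution_def)
  obtain \<Psi> where \<Psi>: "\<Psi> \<in> borel_measurable borel" "\<And>x. \<Psi> (\<Phi> x) = x"
    and \<Phi>: "distr \<mu> borel \<Phi> = uniform_measure lborel {0..1}" "\<Phi> \<in> borel_measurable borel" "range \<Phi> \<subseteq> {0..1}"
    using continuous_strict_mono_cdf[OF \<mu>] assms(7,8) unfolding \<Phi>_def by metis
  have Tm: "?T \<in> ?L \<rightarrow>\<^sub>M cube_space d" by (rule joint_density_measurable(1)[OF \<Phi>(2,3) \<phi>(1) cm])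
  have Tcube: "?T x \<in> unit_cube d" for x using \<Phi>(3) by (auto simp: unit_cube_def)
  have nonneg: "0 \<le> joint_density d h \<Phi> \<phi> x" if "\<forall>u\<in>unit_cube d. 0 \<le> h u" for h x
    using that Tcube \<phi>(2) by (auto simp: joint_density_def intro!: mult_nonneg_nonneg prod_nonneg)

  \<comment> \<open>Passage from the joint densities to the cube\<close>
  have transfer: "emeasure (?D h) (?T -` B \<inter> space ?L) = emeasure (cube_measure d h) B"
    if h: "h \<in> borel_measurable (cube_space d)" and B: "B \<in> sets (cube_space d)" for h B
  proof -
    have "emeasure (distr (?D h) (cube_space d) ?T) B = emeasure (?D h) (?T -` B \<inter> space (?D h))"
      using Tm B by (intro emeasure_distr) auto
    then show ?thesis
      by (simp add: distr_density_joint_density[OF \<mu>p \<mu>_eq \<phi> \<Phi> h])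
  qed

  \<comment> \<open>The law of \<open>X\<close>\<close>
  have law_X: "distr M ?L X = ?D c"
  proof (rule measure_eqI_orthants[of "{1..d}"])
    interpret C: prob_space "cube_measure d c" using copc by (simp add: copula_density_def)
    show "finite_measure (distr M ?L X)"
      using M.prob_space_distr[OF Xm] by (simp add: prob_space_def)
    fix a :: "nat \<Rightarrow> real"
    let ?O = "{x \<in> extensional {1..d}. \<forall>i\<in>{1..d}. x i \<le> a i}"
    let ?B = "{u \<in> unit_cube d. \<forall>i\<in>{1..d}. u i \<le> \<Phi> (a i)}"
    have O: "?O \<in> sets ?L"
    proof -
      have "?O = Pi\<^sub>E {1..d} (\<lambda>i. {..a i})" by (auto simp: PiE_def)
      then show ?thesis by (simp add: sets_PiM_I_finite)
    qed
    have B: "?B \<in> sets (cube_space d)"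
    proof -
      have "?B = unit_cube d \<inter> Pi\<^sub>E {1..d} (\<lambda>i. {..\<Phi> (a i)})" by (auto simp: PiE_def unit_cube_def)
      then show ?thesis by (auto simp: sets_cube_space_iff intro!: sets.Int sets_PiM_I_finite)
    qed
    have "emeasure (distr M ?L X) ?O = emeasure M (X -` ?O \<inter> space M)"
      by (rule emeasure_distr[OF Xm O])
    also have "X -` ?O \<inter> space M = {w \<in> space M. \<forall>k\<in>{1..d}. X w k \<le> a k}"
      using measurable_space[OF Xm] by (auto simp: space_PiM PiE_def)
    also have "emeasure M \<dots> = ennreal (measure (cube_measure d c)
            {u \<in> unit_cube d. \<forall>k\<in>{1..d}. u k \<le> cdf (distr M borel (\<lambda>w. X w k)) (a k)})"
      using assms(5) by (simp add: M.emeasure_eq_measure has_copula_density_def)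
    also have "{u \<in> unit_cube d. \<forall>k\<in>{1..d}. u k \<le> cdf (distr M borel (\<lambda>w. X w k)) (a k)} = ?B"
      using marg \<Phi>_def by auto
    also have "ennreal (measure (cube_measure d c) ?B) = emeasure (cube_measure d c) ?B"
      by (simp add: C.emeasure_eq_measure)
    also have "\<dots> = emeasure (?D c) (?T -` ?B \<inter> space ?L)" by (rule transfer[OF cm B, symmetric])
    \<comment> \<open>Strict growth makes \<open>\<Phi> (x i) \<le> \<Phi> (a i)\<close> equivalent
      to \<open>x i \<le> a i\<close>, so Sklar's relation is equality on orthants.\<close>
    also have "?T -` ?B \<inter> space ?L = ?O"
      using Tcube strict_mono_less_eq[OF assms(8)] by (auto simp: space_PiM PiE_def)
    finally show "emeasure (distr M ?L X) ?O = emeasure (?D c) ?O" .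
  qed auto

  \<comment> \<open>Events of equal mass under both densities\<close>
  let ?S = "\<lambda>u. \<lambda>i\<in>{1..d}. \<Psi> (u i)"
  have Sm: "?S \<in> ?L \<rightarrow>\<^sub>M ?L"
    using measurable_compose[OF measurable_component_singleton[of _ "{1..d}" "\<lambda>_. lborel"]] \<Psi>(1)
    by (intro measurable_restrict) simp
  \<comment> \<open>Since \<open>?S\<close> undoes \<open>?T\<close>, every measurable
    \<open>A\<close> is the preimage of the cube event \<open>?B\<close>, to which the comparison on
    the cube applies.\<close>
  have law_Y: "emeasure (?D ?\<theta>) A = emeasure (?D c) A"
    if A: "A \<in> sets ?L"
      and cancel: "\<And>v. v \<in> Delta0 d \<Longrightarrow> (\<Sum>(\<alpha>, \<beta>)\<in>bits d \<times> perms d.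
        \<epsilon> (\<alpha>, \<beta>) * indicator {u \<in> unit_cube d. ?S u \<in> A} (tau_flip d \<alpha> (sigma_perm d (inv \<beta>) v))) = 0" for A
  proof -
    let ?B = "{u \<in> unit_cube d. ?S u \<in> A}"
    have "?B = unit_cube d \<inter> (?S -` A \<inter> space ?L)"
      using sets.sets_into_space[OF unit_cube_sets] by auto
    then have B: "?B \<in> sets (cube_space d)"
      using measurable_sets[OF Sm A] by (auto simp: sets_cube_space_iff)
    have "?S (?T x) = x" if "x \<in> space ?L" for x
      using that \<Psi>(2) by (auto simp: space_PiM PiE_def extensional_def)
    then have TB: "?T -` ?B \<inter> space ?L = A"
      using Tcube sets.sets_into_space[OF A] by auto
    have "emeasure (cube_measure d ?\<theta>) ?B = emeasure (cube_measure d c) ?B"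
      by (rule emeasure_cube_measure_theta[OF copc \<gamma>i _ B cancel]) (rule bspec[OF \<theta>0])
    then show ?thesis
      unfolding transfer[OF cm B, symmetric] transfer[OF \<theta>m B, symmetric] TB .
  qed

  \<comment> \<open>\<open>?S\<close> works coordinatewise and so commutes with permutations; an
    invariant \<open>A\<close> thus gives a cube event with symmetric indicator, the case of the
    first condition on \<epsilon>.\<close>
  have sym: "emeasure (?D ?\<theta>) A = emeasure (?D c) A"
    if A: "A \<in> sets ?L"
      and inv: "\<And>\<beta> x. \<beta> \<in> perms d \<Longrightarrow> x \<in> extensional {1..d} \<Longrightarrow> sigma_perm d \<beta> x \<in> A \<longleftrightarrow> x \<in> A" for A
  proof (rule law_Y[OF A], rule sum_symmetric_cancel[OF assms(16)])
    show "symmetric_on_tuples d (indicator {u \<in> unit_cube d. ?S u \<in> A} :: _ \<Rightarrow> real)"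
      unfolding symmetric_on_tuples_def
    proof (intro ballI)
      fix \<beta> and x :: "nat \<Rightarrow> real" assume b: "\<beta> \<in> perms d" and "x \<in> {1..d} \<rightarrow>\<^sub>E UNIV"
      then have x: "x \<in> extensional {1..d}" by (simp add: PiE_def)
      have "?S (sigma_perm d \<beta> x) = sigma_perm d \<beta> (?S x)"
        using perms_in[OF b] by (auto simp: sigma_perm_def fun_eq_iff simp del: atLeastAtMost_iff)
      then have "?S (sigma_perm d \<beta> x) \<in> A \<longleftrightarrow> ?S x \<in> A" using inv[OF b] by simp
      moreover have "sigma_perm d \<beta> x \<in> unit_cube d \<longleftrightarrow> x \<in> unit_cube d"
        using sigma_perm_unit_cube[OF b] sigma_perm_unit_cube[OF inv_perms[OF b]]
          sigma_perm_inverse(1)[OF b x] by metis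
      ultimately show "indicator {u \<in> unit_cube d. ?S u \<in> A} (sigma_perm d \<beta> x) =
          (indicator {u \<in> unit_cube d. ?S u \<in> A} x :: real)"
        by (simp add: indicator_def)
    qed
  qed (auto simp: Delta0_def unit_cube_def PiE_def)

  \<comment> \<open>All images of \<open>v\<close> stay in the cube, so there the indicator is a
    function of their \<open>k\<close>-th coordinate alone, the case of the second condition on
    \<epsilon>.\<close>
  have cyl: "emeasure (?D ?\<theta>) {x \<in> space ?L. x k \<in> C} = emeasure (?D c) {x \<in> space ?L. x k \<in> C}"
    if k: "k \<in> {1..d}" and C: "C \<in> sets borel" for k C
  proof (rule law_Y)
    have "(\<lambda>x. x k) \<in> ?L \<rightarrow>\<^sub>M lborel" by (rule measurable_component_singleton[OF k])
    from measurable_sets[OF this, of C] C show "{x \<in> space ?L. x k \<in> C} \<in> sets ?L"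
      by (simp add: vimage_def Int_def conj_commute)
    fix v assume v: "v \<in> Delta0 d"
    have ind: "indicator {u \<in> unit_cube d. ?S u \<in> {x \<in> space ?L. x k \<in> C}} (tau_flip d \<alpha> (sigma_perm d (inv \<beta>) v)) =
        (indicator {t. \<Psi> t \<in> C} (tau_flip d \<alpha> (sigma_perm d (inv \<beta>) v) k) :: real)"
      if "\<alpha> \<in> bits d" "\<beta> \<in> perms d" for \<alpha> \<beta>
    proof -
      have "tau_flip d \<alpha> (sigma_perm d (inv \<beta>) v) \<in> unit_cube d"
        using that v by (auto simp: Delta0_def intro!: tau_flip_unit_cube sigma_perm_unit_cube inv_perms)
      then show ?thesis using k by (simp add: indicator_def space_PiM)
    qed
    have "(\<Sum>(\<alpha>, \<beta>)\<in>bits d \<times> perms d. \<epsilon> (\<alpha>, \<beta>) * indicator {u \<in> unit_cube d. ?S u \<in> {x \<in> space ?L. x k \<in> C}}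
          (tau_flip d \<alpha> (sigma_perm d (inv \<beta>) v))) =
        (\<Sum>(\<alpha>, \<beta>)\<in>bits d \<times> perms d. \<epsilon> (\<alpha>, \<beta>) * indicator {t. \<Psi> t \<in> C} (tau_flip d \<alpha> (sigma_perm d (inv \<beta>) v) k))"
      by (intro sum.cong refl) (clarify, simp only: prod.case ind)
    also have "\<dots> = 0"
      using assms(17) k by (intro sum_coordinate_cancel) auto
    finally show "(\<Sum>(\<alpha>, \<beta>)\<in>bits d \<times> perms d. \<epsilon> (\<alpha>, \<beta>) * indicator {u \<in> unit_cube d. ?S u \<in> {x \<in> space ?L. x k \<in> C}}
          (tau_flip d \<alpha> (sigma_perm d (inv \<beta>) v))) = (0 :: real)" .
  qed

  \<comment> \<open>The density of \<open>X\<close> and the existence of \<open>Y\<close>\<close>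
  have "has_density M d X (joint_density d c \<Phi> \<phi>)"
    using nonneg[OF c0] law_X Xm joint_density_measurable(2)[OF \<Phi>(2,3) \<phi>(1) cm]
    by (simp add: has_density_def distributed_def)
  moreover have "prob_space (?D ?\<theta>)"
  proof
    interpret DX: prob_space "?D c" using M.prob_space_distr[OF Xm] by (simp only: law_X)
    \<comment> \<open>The whole space is invariant under permutations, so total mass 1 carries over
      from the law of \<open>X\<close>.\<close>
    have "emeasure (?D ?\<theta>) (space ?L) = emeasure (?D c) (space ?L)"
      by (rule sym[OF sets.top]) (simp_all add: space_PiM PiE_def)
    then show "emeasure (?D ?\<theta>) (space (?D ?\<theta>)) = 1"
      using DX.emeasure_space_1 by simp
  qed
  \<comment> \<open>\<open>Y\<close> is the identity on tuples, under the measure with the perturbed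
    density.\<close>
  moreover have "has_density (?D ?\<theta>) d (\<lambda>x. x) (joint_density d ?\<theta> \<Phi> \<phi>)"
    using nonneg[OF \<theta>0] joint_density_measurable(2)[OF \<Phi>(2,3) \<phi>(1) \<theta>m]
    by (simp add: has_density_def distributed_def distr_id2)
  moreover have "distr (?D ?\<theta>) borel (\<lambda>x. x k) = distr M borel (\<lambda>w. X w k)" if k: "k \<in> {1..d}" for k
  proof -
    have km: "(\<lambda>x. x k) \<in> borel_measurable ?L"
      using measurable_component_singleton[OF k, of "\<lambda>_. lborel"] by simp
    have "distr (?D ?\<theta>) borel (\<lambda>x. x k) = distr (?D c) borel (\<lambda>x. x k)"
    proof (rule measure_eqI)
      fix C assume "C \<in> sets (distr (?D ?\<theta>) borel (\<lambda>x. x k))"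
      then show "emeasure (distr (?D ?\<theta>) borel (\<lambda>x. x k)) C = emeasure (distr (?D c) borel (\<lambda>x. x k)) C"
        using cyl[OF k, of C] km by (simp add: emeasure_distr vimage_def Int_def conj_commute)
    qed simp
    also have "\<dots> = distr M borel (\<lambda>w. X w k)"
      by (simp add: law_X[symmetric] distr_distr[OF km Xm] comp_def)
    finally show ?thesis .
  qed
  moreover have "distr (?D ?\<theta>) E g = distr M E (\<lambda>w. g (X w))"
    if g: "g \<in> ?L \<rightarrow>\<^sub>M E" and gs: "symmetric_on_tuples d g" for E :: "'b measure" and g
  proof -
    have "distr (?D ?\<theta>) E g = distr (?D c) E g"
    proof (rule measure_eqI)
      fix Z assume "Z \<in> sets (distr (?D ?\<theta>) E g)"
      then have Z: "Z \<in> sets E" by simp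
      \<comment> \<open>A symmetric \<open>g\<close> pulls every event back to a
        permutation-invariant one.\<close>
      have "emeasure (?D ?\<theta>) (g -` Z \<inter> space ?L) = emeasure (?D c) (g -` Z \<inter> space ?L)"
        using gs by (intro sym measurable_sets[OF g Z])
          (auto simp: symmetric_on_tuples_def space_PiM PiE_def)
      then show "emeasure (distr (?D ?\<theta>) E g) Z = emeasure (distr (?D c) E g) Z"
        using g Z by (simp add: emeasure_distr)
    qed simp
    also have "\<dots> = distr M E (\<lambda>w. g (X w))"
      by (simp add: law_X[symmetric] distr_distr[OF g Xm] comp_def)
    finally show ?thesis .
  qed
  ultimately show ?thesis
    by (intro conjI exI[of _ "?D ?\<theta>"] exI[of _ "\<lambda>x. x"]) auto
qed

end
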